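(* Let $d\ge 1$ and let $k$ be a positive integer with $k\le 2d$. Consider the constrained-degree percolation model on $\mathbb{L}^d$ with constraint $k$. The percolation function $t\mapsto\theta(t)$ is continuous on the interval $(t_c,1)$.
   Context: $\mathbb{L}^d=(\mathbb{Z}^d,\mathcal{E}^d)$ is the hypercubic lattice with nearest-neighbor edge set $\mathcal{E}^d$. Constrained-degree percolation (CDP) with constraint $k$: let $U=(U_e)_{e\in\mathcal{E}^d}$ (the collection of clocks) be i.i.d. random variables, uniform on $[0,1]$, and let $\mathbb{P}$ be the corresponding product probability measure on $[0,1]^{\mathcal{E}^d}$. At time $0$ all edges are closed. An edge $e=\langle u,v\rangle$ opens at time $U_e$ if, for all $s<U_e$, $$\max\{|\{x\in\mathbb{Z}^d:\langle x,u\rangle\text{ is open at time }s\}|,\ |\{x\in\mathbb{Z}^d:\langle x,v\rangle\text{ is open at time }s\}|\}<k;$$ otherwise it never opens. Once open, an edge remains open. For almost every $U$ this determines the state of every edge at every time. The open clusters at time $t$ are the connected components of the subgraph of $\mathbb{L}^d$ formed by the edges open at time $t$. $0\longleftrightarrow\infty$ at time $t$ means that the open cluster of the origin at time $t$ is infinite. Define, for $t\in[0,1]$, $\theta(t)=\mathbb{P}(0\longleftrightarrow\infty\text{ at time }t)$, which is non-decreasing in $t$, and the critical threshold $t_c=\inf\{t\in[0,1]:\theta(t)>0\}$ (with the usual convention $\inf\emptyset=+\infty$, in which case the interval $(t_c,1)$ is empty). *)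

theory Defs
  imports "HOL-Probability.Probability"
begin

text \<open>The lattice \<open>\<int>\<^sup>d\<close> is the type \<open>int ^ 'd\<close> with \<open>d = CARD('d)\<close>; an edge is the unordered
  pair \<open>{u, v}\<close> of its endpoints.\<close>

definition lattice_edges :: "(int ^ 'd) set set" where
  "lattice_edges = {{u, v} | u v. (\<Sum>i\<in>UNIV. \<bar>u $ i - v $ i\<bar>) = 1}"

definition clock_measure :: "((int ^ 'd) set \<Rightarrow> real) measure" where
  "clock_measure = (\<Pi>\<^sub>M e\<in>lattice_edges. restrict_space lborel {0..1})"

definition open_degree :: "(int ^ 'd) set set \<Rightarrow> int ^ 'd \<Rightarrow> nat" where
  "open_degree B v = card {x. {x, v} \<in> B}"

text \<open>\<open>A s\<close> is the set of edges open at time \<open>s\<close>. For clocks in \<open>[0, 1]\<close> nothing is open at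
  negative times, so letting \<open>s\<close> range over all reals below \<open>U e\<close> is harmless for \<open>k \<ge> 1\<close>.
  Requiring \<open>A 0 = {}\<close> only excludes clocks with \<open>U e = 0\<close> for some \<open>e\<close>, a null event.\<close>

definition cdp_evolution ::
    "nat \<Rightarrow> ((int ^ 'd) set \<Rightarrow> real) \<Rightarrow> (real \<Rightarrow> (int ^ 'd) set set) \<Rightarrow> bool" where
  "cdp_evolution k U A \<longleftrightarrow>
     A 0 = {} \<and>
     (\<forall>t. A t = {e \<in> lattice_edges. U e \<le> t \<and> (\<forall>s<U e. \<forall>v\<in>e. open_degree (A s) v < k)})"

text \<open>For almost every \<open>U\<close> there is exactly one evolution: almost surely no infinite sequence of
  successively adjacent edges has strictly decreasing clocks, so the state of an edge is
  determined by well-founded recursion. On the remaining null set the value is arbitrary.\<close>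

definition open_edges :: "nat \<Rightarrow> ((int ^ 'd) set \<Rightarrow> real) \<Rightarrow> real \<Rightarrow> (int ^ 'd) set set" where
  "open_edges k U = (THE A. cdp_evolution k U A)"

definition open_cluster :: "(int ^ 'd) set set \<Rightarrow> int ^ 'd \<Rightarrow> (int ^ 'd) set" where
  "open_cluster B v = {w. (\<lambda>x y. {x, y} \<in> B)\<^sup>*\<^sup>* v w}"

text \<open>The completion is used because \<^const>\<open>open_edges\<close> is only controlled almost everywhere: the
  event below agrees with a product-measurable set up to a subset of a null set.\<close>

definition percolation_function :: "'d::finite itself \<Rightarrow> nat \<Rightarrow> real \<Rightarrow> real" where
  "percolation_function _ k t =
     measure (completion clock_measure)
       {U \<in> space clock_measure. infinite (open_cluster (open_edges k U t) (0 :: int ^ 'd))}"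

text \<open>Valued in \<^typ>\<open>ereal\<close>, so that the infimum of the empty set is \<open>\<infinity>\<close>.\<close>

definition critical_time :: "'d::finite itself \<Rightarrow> nat \<Rightarrow> ereal" where
  "critical_time D k = Inf (ereal ` {t \<in> {0..1}. percolation_function D k t > 0})"

end

theory Submission
  imports Defs
begin

text \<open>Right continuity is deterministic: the edge boundary of a finite cluster is finite.

  Left continuity at \<open>t\<close> can only fail if, with positive probability, the cluster of \<open>0\<close> at time \<open>t\<close>
  is infinite but contains no vertex whose cluster is infinite at a fixed time \<open>s\<close> with
  \<open>t\<^sub>c < s < t\<close>. By ergodicity, infinite clusters at time \<open>s\<close> exist almost surely. Resampling
  finitely many clocks, and using that clocks may be moved past \<open>t < 1\<close>, one can then change the
  configuration only along a shortest path so that the former cluster hangs by a single edge on a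
  cluster containing an infinite cluster of time \<open>s\<close> (for \<open>k \<ge> 2\<close>; there is nothing to do for
  \<open>k = 1\<close>). Let every vertex distribute mass one evenly among the nearest vertices, in the graph
  distance at time \<open>t\<close>, that percolate at time \<open>s\<close>. Then infinitely many vertices send the same
  amount of mass to the same vertex, which contradicts the mass transport principle. No uniqueness
  of the infinite cluster is needed.\<close>

section \<open>Lattice edges and the recursion for the open edges\<close>

text \<open>The obstacle is that a change at one edge can spread: delaying a clock closes an edge,
  which may let a neighbour open, which may block a third edge, and so on. The model is not monotone
  and has no finite energy property. The surgery is arranged so that no such cascade starts. Closed
  edges that could react are delayed past \<open>t\<close> together with the removed ones. The path
  edges ring after a time \<open>r\<close>, while the two old edges left at the ends of the path
  ring before \<open>r\<close> and so cannot be blocked by it. A path vertex then has at most two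
  open neighbours, which is where \<open>k \<ge> 2\<close> comes from.

  The surgery is an affine map of finitely many clocks. It pulls null sets back to null sets, so
  almost sure properties persist after it. With \<open>r\<close> rational there are countably many
  surgeries, which can be controlled all at once. Hence no probability of a modified configuration
  is computed: outside a fixed null set, a single configuration violating left continuity is already
  contradictory.\<close>

lemma lattice_edge_iff:
  "{u, v} \<in> lattice_edges \<longleftrightarrow> (\<Sum>i\<in>UNIV. \<bar>(u :: int ^ 'd) $ i - v $ i\<bar>) = 1"
proof
  assume "{u, v} \<in> lattice_edges"
  then obtain a b where ab: "{u, v} = {a, b}" "(\<Sum>i\<in>UNIV. \<bar>(a :: int ^ 'd) $ i - b $ i\<bar>) = 1"
    unfolding lattice_edges_def by blast
  from ab(1) consider "u = a" "v = b" | "u = b" "v = a" by (auto simp: doubleton_eq_iff)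
  then show "(\<Sum>i\<in>UNIV. \<bar>u $ i - v $ i\<bar>) = 1"
    using ab(2) by cases (auto simp: abs_minus_commute)
qed (auto simp: lattice_edges_def)

lemma lattice_edgeE:
  assumes "e \<in> lattice_edges"
  obtains u v where "e = {u, v}" "u \<noteq> v" "{u, v} \<in> lattice_edges"
proof -
  obtain u v where uv: "e = {u, v}" using assms unfolding lattice_edges_def by blast
  have "u \<noteq> v" using assms lattice_edge_iff[of u v] unfolding uv by auto
  then show ?thesis using that uv assms by blast
qed

lemma no_loop: "{v, v} \<notin> lattice_edges"
  unfolding lattice_edge_iff by simp

lemma countable_lattice_edges: "countable (lattice_edges :: (int ^ 'd) set set)"
proof (rule countable_subset)
  show "lattice_edges \<subseteq> (\<lambda>(u, v). {u, v :: int ^ 'd}) ` UNIV"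
    unfolding lattice_edges_def by auto
qed auto

lemma finite_neighbours: "finite {x. {x, v :: int ^ 'd} \<in> lattice_edges}"
proof -
  have fin: "finite (Pi\<^sub>E (UNIV :: 'd set) (\<lambda>i. {v $ i - 1..v $ i + 1}))"
    by (intro finite_PiE) auto
  have "{x. {x, v} \<in> lattice_edges} \<subseteq> vec_lambda ` (Pi\<^sub>E UNIV (\<lambda>i. {v $ i - 1..v $ i + 1}))"
  proof
    fix x assume "x \<in> {x. {x, v} \<in> lattice_edges}"
    then have *: "(\<Sum>i\<in>UNIV. \<bar>x $ i - v $ i\<bar>) = 1" by (simp add: lattice_edge_iff)
    have "\<bar>x $ i - v $ i\<bar> \<le> 1" for i
      using member_le_sum[of i UNIV "\<lambda>i. \<bar>x $ i - v $ i\<bar>"] * by simp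
    then have "x $ i \<in> {v $ i - 1..v $ i + 1}" for i by (smt (verit) atLeastAtMost_iff)
    then show "x \<in> vec_lambda ` (Pi\<^sub>E UNIV (\<lambda>i. {v $ i - 1..v $ i + 1}))"
      by (intro image_eqI[of _ _ "vec_nth x"]) (auto simp: vec_nth_inverse PiE_UNIV_domain)
  qed
  then show ?thesis using fin finite_subset finite_imageI by blast
qed

lemma translate_edge:
  "(\<lambda>v. v + z) ` e \<in> lattice_edges \<longleftrightarrow> e \<in> (lattice_edges :: (int ^ 'd) set set)"
proof -
  have 1: "(\<lambda>v. v + z) ` e \<in> lattice_edges" if e: "e \<in> lattice_edges" for z :: "int ^ 'd" and e
  proof -
    obtain u v where "e = {u, v}" "{u, v} \<in> lattice_edges" using lattice_edgeE[OF e] by metis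
    then show ?thesis by (simp add: lattice_edge_iff)
  qed
  have "(\<lambda>v. v + - z) ` (\<lambda>v. v + z) ` e = e" by (simp add: image_image)
  then show ?thesis using 1[of e z] 1[of "(\<lambda>v. v + z) ` e" "- z"] by auto
qed

text \<open>An edge is adjacent to itself here. Repetitions are excluded where it matters: by the
  strict inequality of clocks in \<open>earlier\<close> and by \<open>distinct\<close> for
  chains.\<close>

definition adjacent_edges :: "(int ^ 'd) set \<Rightarrow> (int ^ 'd) set set" where
  "adjacent_edges e = {f \<in> lattice_edges. f \<inter> e \<noteq> {}}"

text \<open>By translation every vertex has the degree of the origin, so the bound is the same for
  all edges. It becomes the branching number in the count of chains.\<close>

lemma adjacent_edges_le:
  fixes e :: "(int ^ 'd) set"
  assumes "e \<in> lattice_edges"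
  shows "finite (adjacent_edges e) \<and>
     card (adjacent_edges e) \<le> 2 * card {x. {x, 0 :: int ^ 'd} \<in> lattice_edges}"
proof -
  obtain u v where e: "e = {u, v}" using lattice_edgeE[OF assms] by metis
  let ?N = "\<lambda>v. {x. {x, v :: int ^ 'd} \<in> lattice_edges}"
  have N: "?N v = (\<lambda>x. x + v) ` ?N 0" for v
  proof (rule set_eqI)
    fix x
    have "{x, v} \<in> lattice_edges \<longleftrightarrow> {x - v, 0} \<in> lattice_edges"
      by (simp add: lattice_edge_iff)
    then show "x \<in> ?N v \<longleftrightarrow> x \<in> (\<lambda>x. x + v) ` ?N 0"
      by (auto intro!: image_eqI[of _ _ "x - v"] simp: lattice_edge_iff)
  qed
  have sub: "adjacent_edges e \<subseteq> (\<lambda>x. {x, u}) ` ?N u \<union> (\<lambda>x. {x, v}) ` ?N v"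
  proof
    fix f assume f: "f \<in> adjacent_edges e"
    then obtain a b where ab: "f = {a, b}" "{a, b} \<in> lattice_edges"
      using lattice_edgeE[of f] unfolding adjacent_edges_def by blast
    have "a = u \<or> a = v \<or> b = u \<or> b = v" using f ab(1) e unfolding adjacent_edges_def by auto
    then show "f \<in> (\<lambda>x. {x, u}) ` ?N u \<union> (\<lambda>x. {x, v}) ` ?N v"
      using ab by (auto simp: insert_commute)
  qed
  have fin: "finite (?N w)" for w by (rule finite_neighbours)
  have c: "card (?N w) = card (?N 0)" for w
    unfolding N[of w] by (rule card_image) (simp add: inj_on_def)
  have "card (adjacent_edges e) \<le> card ((\<lambda>x. {x, u}) ` ?N u \<union> (\<lambda>x. {x, v}) ` ?N v)"
    by (intro card_mono sub finite_UnI finite_imageI fin)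
  also have "\<dots> \<le> card ((\<lambda>x. {x, u}) ` ?N u) + card ((\<lambda>x. {x, v}) ` ?N v)"
    by (rule card_Un_le)
  also have "\<dots> \<le> card (?N u) + card (?N v)"
    by (intro add_mono card_image_le fin)
  finally have "card (adjacent_edges e) \<le> 2 * card (?N 0)" using c[of u] c[of v] by linarith
  moreover have "finite (adjacent_edges e)"
    using sub by (rule finite_subset) (intro finite_UnI finite_imageI fin)
  ultimately show ?thesis by blast
qed

lemma finite_adjacent_edges: "e \<in> lattice_edges \<Longrightarrow> finite (adjacent_edges e)"
  using adjacent_edges_le by blast

section \<open>The recursion for the set of edges that ever open\<close>

text \<open>The model asks for a small degree at all times before the clock of \<open>e\<close>.
  Degrees grow in time, so one count of the open edges with smaller clocks suffices, and no time
  variable enters the recursion.\<close>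

definition admissible ::
    "nat \<Rightarrow> ((int ^ 'd) set \<Rightarrow> real) \<Rightarrow> (int ^ 'd) set set \<Rightarrow> (int ^ 'd) set \<Rightarrow> bool" where
  "admissible k U S e \<longleftrightarrow> (\<forall>v\<in>e. card {x. {x, v} \<in> S \<and> U {x, v} < U e} < k)"

primrec opened_approx :: "nat \<Rightarrow> ((int ^ 'd) set \<Rightarrow> real) \<Rightarrow> nat \<Rightarrow> (int ^ 'd) set set" where
  "opened_approx k U 0 = {}"
| "opened_approx k U (Suc n) = {e \<in> lattice_edges. admissible k U (opened_approx k U n) e}"

text \<open>The limit of the approximations makes sense for every clock configuration and is measurable
  by construction; it solves the recursion as soon as the clocks are well-founded.\<close>

definition opened :: "nat \<Rightarrow> ((int ^ 'd) set \<Rightarrow> real) \<Rightarrow> (int ^ 'd) set set" where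
  "opened k U = {e. \<exists>N. \<forall>n\<ge>N. e \<in> opened_approx k U n}"

definition open_by :: "nat \<Rightarrow> ((int ^ 'd) set \<Rightarrow> real) \<Rightarrow> real \<Rightarrow> (int ^ 'd) set set" where
  "open_by k U t = {e \<in> opened k U. U e \<le> t}"

definition earlier :: "((int ^ 'd) set \<Rightarrow> real) \<Rightarrow> (int ^ 'd) set rel" where
  "earlier U = {(f, e). e \<in> lattice_edges \<and> f \<in> adjacent_edges e \<and> U f < U e}"

lemma opened_approx_lattice: "opened_approx k U n \<subseteq> lattice_edges"
  by (cases n) auto

lemma opened_lattice: "opened k U \<subseteq> lattice_edges"
  unfolding opened_def using opened_approx_lattice by blast

lemma open_by_lattice: "open_by k U t \<subseteq> lattice_edges"
  unfolding open_by_def using opened_lattice by blast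

lemma open_by_mono: "s \<le> t \<Longrightarrow> open_by k U s \<subseteq> open_by k U t"
  unfolding open_by_def by auto

lemma admissible_cong:
  assumes "S \<subseteq> lattice_edges" "S' \<subseteq> lattice_edges" "e \<in> lattice_edges"
    and "\<And>f. (f, e) \<in> earlier U \<Longrightarrow> f \<in> S \<longleftrightarrow> f \<in> S'"
  shows "admissible k U S e \<longleftrightarrow> admissible k U S' e"
proof -
  have "{x. {x, v} \<in> S \<and> U {x, v} < U e} = {x. {x, v} \<in> S' \<and> U {x, v} < U e}" if "v \<in> e" for v
    using assms that unfolding earlier_def adjacent_edges_def by auto
  then show ?thesis unfolding admissible_def by simp
qed

text \<open>The state of an edge depends only on the finitely many adjacent edges with smaller
  clocks. Once these have settled in the approximation, the edge settles one step later.
  Well-founded induction works without a uniform bound on the number of steps.\<close>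

lemma opened_approx_stable:
  assumes "wf (earlier U)"
  shows "\<exists>N. \<forall>n\<ge>N. e \<in> opened_approx k U n \<longleftrightarrow> e \<in> opened k U"
  using assms
proof (induction e rule: wf_induct_rule)
  case (less e)
  show ?case
  proof (cases "e \<in> lattice_edges")
    case False
    then show ?thesis using opened_approx_lattice opened_lattice by blast
  next
    case True
    define P where "P = {f. (f, e) \<in> earlier U}"
    have "finite P"
      by (rule finite_subset[OF _ finite_adjacent_edges[OF True]]) (auto simp: P_def earlier_def)
    moreover have "\<forall>f\<in>P. \<exists>N. \<forall>n\<ge>N. f \<in> opened_approx k U n \<longleftrightarrow> f \<in> opened k U"
      using less.IH unfolding P_def by blast
    ultimately have "eventually (\<lambda>n. \<forall>f\<in>P. f \<in> opened_approx k U n \<longleftrightarrow> f \<in> opened k U) sequentially"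
      by (intro eventually_ball_finite) (simp_all add: eventually_sequentially)
    then obtain N where N: "\<And>n f. n \<ge> N \<Longrightarrow> f \<in> P \<Longrightarrow> f \<in> opened_approx k U n \<longleftrightarrow> f \<in> opened k U"
      unfolding eventually_sequentially by blast
    have eq: "e \<in> opened_approx k U n \<longleftrightarrow> admissible k U (opened k U) e" if n: "n \<ge> Suc N" for n
    proof -
      obtain m where m: "n = Suc m" "m \<ge> N" using n by (metis Suc_le_D Suc_le_mono)
      have "admissible k U (opened_approx k U m) e \<longleftrightarrow> admissible k U (opened k U) e"
        by (rule admissible_cong[OF opened_approx_lattice opened_lattice True])
          (use N m P_def in auto)
      then show ?thesis using True m by simp
    qed
    have "e \<in> opened k U \<longleftrightarrow> admissible k U (opened k U) e"
    proof
      assume "e \<in> opened k U"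
      then obtain M where M: "\<forall>n\<ge>M. e \<in> opened_approx k U n" unfolding opened_def by blast
      show "admissible k U (opened k U) e" using M eq[of "max M (Suc N)"] by simp
    next
      assume "admissible k U (opened k U) e"
      then have "\<forall>n\<ge>Suc N. e \<in> opened_approx k U n" using eq by blast
      then show "e \<in> opened k U" unfolding opened_def by blast
    qed
    with eq show ?thesis by blast
  qed
qed

lemma opened_iff:
  assumes "wf (earlier U)"
  shows "e \<in> opened k U \<longleftrightarrow> e \<in> lattice_edges \<and> admissible k U (opened k U) e"
proof (cases "e \<in> lattice_edges")
  case False
  then show ?thesis using opened_lattice by blast
next
  case True
  define P where "P = insert e {f. (f, e) \<in> earlier U}"
  have "finite P"
    unfolding P_def using finite_subset[OF _ finite_adjacent_edges[OF True], of "{f. (f, e) \<in> earlier U}"]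
    by (auto simp: earlier_def)
  moreover have "\<forall>f\<in>P. \<exists>N. \<forall>n\<ge>N. f \<in> opened_approx k U n \<longleftrightarrow> f \<in> opened k U"
    using opened_approx_stable[OF assms] by blast
  ultimately have "eventually (\<lambda>n. \<forall>f\<in>P. f \<in> opened_approx k U n \<longleftrightarrow> f \<in> opened k U) sequentially"
    by (intro eventually_ball_finite) (simp_all add: eventually_sequentially)
  then obtain N where N: "\<And>n f. n \<ge> N \<Longrightarrow> f \<in> P \<Longrightarrow> f \<in> opened_approx k U n \<longleftrightarrow> f \<in> opened k U"
    unfolding eventually_sequentially by blast
  have "e \<in> opened k U \<longleftrightarrow> e \<in> opened_approx k U (Suc N)"
    using N[of "Suc N" e] by (simp add: P_def)
  also have "\<dots> \<longleftrightarrow> admissible k U (opened_approx k U N) e" using True by simp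
  also have "\<dots> \<longleftrightarrow> admissible k U (opened k U) e"
    by (rule admissible_cong[OF opened_approx_lattice opened_lattice True])
      (use N P_def in auto)
  finally show ?thesis using True by simp
qed

text \<open>The degree before the clock of \<open>e\<close> is largest at the last time at which an
  open edge at \<open>v\<close> rings, and local finiteness makes this a maximum that is
  attained.\<close>

lemma admissible_degree:
  assumes S: "S \<subseteq> lattice_edges" and k: "k \<ge> 1"
  shows "admissible k U S e \<longleftrightarrow>
    (\<forall>s<U e. \<forall>v\<in>e. open_degree {f \<in> S. U f \<le> s} v < k)"
proof -
  have fin: "finite {x. {x, v} \<in> S \<and> P x}" for v P
    by (rule finite_subset[OF _ finite_neighbours[of v]]) (use S in auto)
  have "card {x. {x, v} \<in> S \<and> U {x, v} < U e} < k \<longleftrightarrow>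
      (\<forall>s<U e. open_degree {f \<in> S. U f \<le> s} v < k)" for v
  proof safe
    fix s assume c: "card {x. {x, v} \<in> S \<and> U {x, v} < U e} < k" and s: "s < U e"
    have "card {x. {x, v} \<in> {f \<in> S. U f \<le> s}} \<le> card {x. {x, v} \<in> S \<and> U {x, v} < U e}"
      by (rule card_mono[OF fin]) (use s in auto)
    then show "open_degree {f \<in> S. U f \<le> s} v < k"
      unfolding open_degree_def using c by linarith
  next
    assume *: "\<forall>s<U e. open_degree {f \<in> S. U f \<le> s} v < k"
    let ?X = "{x. {x, v} \<in> S \<and> U {x, v} < U e}"
    show "card ?X < k"
    proof (cases "?X = {}")
      case True
      \<comment> \<open>There is no last ringing time here: the count is 0, and
        \<open>k \<ge> 1\<close> decides.\<close>
      then show ?thesis using k by (simp only: card.empty)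
    next
      case False
      define s where "s = Max ((\<lambda>x. U {x, v}) ` ?X)"
      have "s \<in> (\<lambda>x. U {x, v}) ` ?X" unfolding s_def using False fin by (intro Max_in) auto
      then have s: "s < U e" by auto
      have "U {x, v} \<le> s" if "x \<in> ?X" for x
        unfolding s_def using that fin by (intro Max_ge) auto
      then have "?X = {x. {x, v} \<in> {f \<in> S. U f \<le> s}}" using s by auto
      then have "card ?X = open_degree {f \<in> S. U f \<le> s} v"
        unfolding open_degree_def by (rule arg_cong)
      then show ?thesis using * s by simp
    qed
  qed
  then show ?thesis unfolding admissible_def by blast
qed

text \<open>An evolution is determined by the set \<open>S\<close> of edges that open at some time,
  since each of them is open exactly from its clock on. \<open>S\<close> and
  \<open>opened k U\<close> solve the same recursion, which has only one solution over a
  well-founded relation. Positive clocks give the condition at time 0.\<close>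

lemma cdp_evolution_iff:
  assumes wf: "wf (earlier U)" and pos: "\<And>e. e \<in> lattice_edges \<Longrightarrow> U e > 0" and k: "k \<ge> 1"
  shows "cdp_evolution k U A \<longleftrightarrow> A = open_by k U"
proof
  assume A: "cdp_evolution k U A"
  define S where "S = {e \<in> lattice_edges. \<forall>s<U e. \<forall>v\<in>e. open_degree (A s) v < k}"
  have At: "A t = {e \<in> S. U e \<le> t}" for t
  proof -
    have "A t = {e \<in> lattice_edges. U e \<le> t \<and> (\<forall>s<U e. \<forall>v\<in>e. open_degree (A s) v < k)}"
      using A unfolding cdp_evolution_def by blast
    also have "\<dots> = {e \<in> S. U e \<le> t}" unfolding S_def by blast
    finally show ?thesis .
  qed
  have SL: "S \<subseteq> lattice_edges" unfolding S_def by auto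
  have S: "e \<in> S \<longleftrightarrow> e \<in> lattice_edges \<and> admissible k U S e" for e
    unfolding admissible_degree[OF SL k] At[symmetric] by (simp add: S_def)
  have "e \<in> S \<longleftrightarrow> e \<in> opened k U" for e
    using wf
  proof (induction e rule: wf_induct_rule)
    case (less e)
    show ?case
      unfolding S[of e] opened_iff[OF wf, of e]
      using admissible_cong[OF SL opened_lattice] less.IH by blast
  qed
  then show "A = open_by k U" using At unfolding open_by_def by blast
next
  assume A: "A = open_by k U"
  have 0: "A 0 = {}" unfolding A open_by_def using pos opened_lattice by force
  have "A t = {e \<in> lattice_edges. U e \<le> t \<and> (\<forall>s<U e. \<forall>v\<in>e. open_degree (A s) v < k)}" for t
    unfolding A open_by_def admissible_degree[OF opened_lattice k, symmetric]
    using opened_iff[OF wf] by blast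
  with 0 show "cdp_evolution k U A" unfolding cdp_evolution_def by blast
qed

lemma open_edges_eq:
  assumes "wf (earlier U)" "\<And>e. e \<in> lattice_edges \<Longrightarrow> U e > 0" "k \<ge> 1"
  shows "open_edges k U = open_by k U"
  unfolding open_edges_def by (rule the_equality) (simp_all add: cdp_evolution_iff[OF assms])

section \<open>Clusters and local modifications\<close>

text \<open>The ball of radius \<open>n\<close> in the graph distance of \<open>B\<close>. Working
  with balls avoids assigning a distance to unreachable vertices and keeps measurability proofs to
  inductions on \<open>n\<close>.\<close>

primrec reach :: "(int ^ 'd) set set \<Rightarrow> nat \<Rightarrow> int ^ 'd \<Rightarrow> (int ^ 'd) set" where
  "reach B 0 v = {v}"
| "reach B (Suc n) v = reach B n v \<union> {w. \<exists>u\<in>reach B n v. {u, w} \<in> B}"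

lemma reach_mono: "m \<le> n \<Longrightarrow> reach B m v \<subseteq> reach B n v"
  by (induction n) (auto simp: le_Suc_eq)

lemma reach_trans: "u \<in> reach B m v \<Longrightarrow> w \<in> reach B n u \<Longrightarrow> w \<in> reach B (m + n) v"
  by (induction n arbitrary: w) auto

lemma finite_reach: "B \<subseteq> lattice_edges \<Longrightarrow> finite (reach B n v)"
proof (induction n)
  case (Suc n)
  have "reach B (Suc n) v \<subseteq> reach B n v \<union> (\<Union>u\<in>reach B n v. {w. {w, u} \<in> lattice_edges})"
    using Suc.prems by (auto simp: insert_commute)
  moreover have "finite (reach B n v \<union> (\<Union>u\<in>reach B n v. {w. {w, u} \<in> lattice_edges}))"
    using Suc finite_neighbours by auto
  ultimately show ?case by (rule finite_subset)
qed auto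

lemma open_cluster_reach: "open_cluster B v = (\<Union>n. reach B n v)"
proof (intro equalityI subsetI)
  fix w assume "w \<in> open_cluster B v"
  then have "(\<lambda>x y. {x, y} \<in> B)\<^sup>*\<^sup>* v w" unfolding open_cluster_def by simp
  then show "w \<in> (\<Union>n. reach B n v)"
  proof (induction rule: rtranclp_induct)
    case base
    then show ?case by (auto intro: exI[of _ 0])
  next
    case (step y z)
    then obtain n where "y \<in> reach B n v" by blast
    then have "z \<in> reach B (Suc n) v" using step by auto
    then show ?case by blast
  qed
next
  fix w assume "w \<in> (\<Union>n. reach B n v)"
  then obtain n where "w \<in> reach B n v" by blast
  then show "w \<in> open_cluster B v"
    unfolding open_cluster_def
  proof (induction n arbitrary: w)
    case (Suc n)
    then show ?case by (auto intro: rtranclp.rtrancl_into_rtrancl)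
  qed auto
qed

lemma open_cluster_refl [simp]: "v \<in> open_cluster B v"
  unfolding open_cluster_def by simp

lemma open_cluster_step: "w \<in> open_cluster B v \<Longrightarrow> {w, x} \<in> B \<Longrightarrow> x \<in> open_cluster B v"
  unfolding open_cluster_def by (auto intro: rtranclp.rtrancl_into_rtrancl)

lemma open_cluster_trans:
  "w \<in> open_cluster B v \<Longrightarrow> x \<in> open_cluster B w \<Longrightarrow> x \<in> open_cluster B v"
  unfolding open_cluster_def by (auto intro: rtranclp_trans)

lemma open_cluster_sym: "w \<in> open_cluster B v \<Longrightarrow> v \<in> open_cluster B w"
proof -
  have "symp (\<lambda>x y. {x, y} \<in> B)" by (auto intro: sympI simp: insert_commute)
  then show "w \<in> open_cluster B v \<Longrightarrow> v \<in> open_cluster B w"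
    unfolding open_cluster_def by (auto dest: sympD[OF symp_rtranclp])
qed

lemma open_cluster_eq: "w \<in> open_cluster B v \<Longrightarrow> open_cluster B w = open_cluster B v"
  using open_cluster_sym open_cluster_trans by blast

lemma open_cluster_mono: "B \<subseteq> B' \<Longrightarrow> open_cluster B v \<subseteq> open_cluster B' v"
  unfolding open_cluster_def by (auto elim!: rtranclp_mono[THEN predicate2D, rotated])

lemma open_cluster_subset:
  assumes "v \<in> K" "\<And>u w. u \<in> K \<Longrightarrow> {u, w} \<in> B \<Longrightarrow> w \<in> K"
  shows "open_cluster B v \<subseteq> K"
proof
  fix w assume "w \<in> open_cluster B v"
  then have "(\<lambda>x y. {x, y} \<in> B)\<^sup>*\<^sup>* v w" unfolding open_cluster_def by simp
  then show "w \<in> K" using assms by induction auto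
qed

text \<open>Deleting \<open>x\<close> splits its cluster into the clusters of its finitely many
  neighbours, one of which must be infinite. The surgery keeps just one old edge at each end of the
  path, so that edge has to lead to an infinite piece on its own.\<close>

lemma infinite_branch:
  assumes B: "B \<subseteq> lattice_edges" and inf: "infinite (open_cluster B x)"
  obtains c where "{x, c} \<in> B" "infinite (open_cluster {e \<in> B. x \<notin> e} c)"
proof -
  let ?D = "\<lambda>c. open_cluster {e \<in> B. x \<notin> e} c"
  let ?N = "{c. {c, x} \<in> B}"
  have fin: "finite ?N" by (rule finite_subset[OF _ finite_neighbours[of x]]) (use B in auto)
  have "open_cluster B x \<subseteq> insert x (\<Union>c\<in>?N. ?D c)"
  proof (rule open_cluster_subset)
    fix u w assume u: "u \<in> insert x (\<Union>c\<in>?N. ?D c)" and uw: "{u, w} \<in> B"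
    show "w \<in> insert x (\<Union>c\<in>?N. ?D c)"
    proof (cases "u = x \<or> w = x")
      case True
      then show ?thesis using uw by (auto simp: insert_commute intro!: exI[of _ w])
    next
      case False
      then obtain c where "c \<in> ?N" "u \<in> ?D c" using u by blast
      moreover have "{u, w} \<in> {e \<in> B. x \<notin> e}" using uw False by auto
      ultimately show ?thesis using open_cluster_step by blast
    qed
  qed simp
  then have "infinite (\<Union>c\<in>?N. ?D c)" using inf by (meson finite_insert finite_subset)
  then obtain c where "c \<in> ?N" "infinite (?D c)" using fin by blast
  then show ?thesis using that[of c] by (simp add: insert_commute)
qed

text \<open>If \<open>c\<close> is a neighbour of \<open>v\<close>, then \<open>v\<close> is the
  only neighbour of \<open>c\<close>, so deleting \<open>v\<close> leaves \<open>c\<close> isolated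
  and no branch can be infinite.\<close>

lemma finite_cluster_degree_one:
  assumes B: "B \<subseteq> lattice_edges" and deg: "\<And>v. card {x. {x, v} \<in> B} \<le> 1"
  shows "finite (open_cluster B v)"
proof (rule ccontr)
  assume "infinite (open_cluster B v)"
  then obtain c where c: "{v, c} \<in> B" "infinite (open_cluster {e \<in> B. v \<notin> e} c)"
    using infinite_branch[OF B] by blast
  have "open_cluster {e \<in> B. v \<notin> e} c \<subseteq> {c}"
  proof (rule open_cluster_subset)
    fix u w assume u: "u \<in> {c}" and uw: "{u, w} \<in> {e \<in> B. v \<notin> e}"
    have "{x. {x, c} \<in> B} \<subseteq> {x. {x, c} \<in> lattice_edges}" using B by auto
    then have fin: "finite {x. {x, c} \<in> B}" using finite_neighbours finite_subset by blast
    have "card {v, w} \<le> card {x. {x, c} \<in> B}"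
      by (rule card_mono[OF fin]) (use c(1) u uw in \<open>auto simp: insert_commute\<close>)
    then have "card {v, w} \<le> 1" using deg[of c] by linarith
    then show "w \<in> {c}" using uw by (auto simp: card_insert_if split: if_splits)
  qed simp
  then show False using c(2) finite_subset by blast
qed

text \<open>Induction on the l1 distance: a unit step towards \<open>w\<close> in a coordinate where
  the two vertices differ.\<close>

lemma open_cluster_lattice: "w \<in> open_cluster lattice_edges (v :: int ^ 'd)"
proof (induction "nat (\<Sum>i\<in>UNIV. \<bar>v $ i - w $ i\<bar>)" arbitrary: v rule: less_induct)
  case less
  show ?case
  proof (cases "v = w")
    case False
    then obtain i where i: "v $ i \<noteq> w $ i" by (metis vec_eq_iff)
    define u where "u = v + axis i (sgn (w $ i - v $ i))"
    have u: "u $ j = (if j = i then v $ j + sgn (w $ i - v $ i) else v $ j)" for j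
      by (simp add: u_def axis_def)
    have "(\<Sum>j\<in>UNIV. \<bar>v $ j - u $ j\<bar>) = (\<Sum>j\<in>UNIV. if j = i then 1 else 0)"
      by (rule sum.cong) (use i in \<open>auto simp: u sgn_if\<close>)
    then have uv: "{v, u} \<in> lattice_edges" by (simp add: lattice_edge_iff)
    have "(\<Sum>j\<in>UNIV. \<bar>u $ j - w $ j\<bar>) < (\<Sum>j\<in>UNIV. \<bar>v $ j - w $ j\<bar>)"
      by (rule sum_strict_mono_ex1) (use i in \<open>auto simp: u sgn_if intro!: exI[of _ i]\<close>)
    moreover have "0 \<le> (\<Sum>j\<in>UNIV. \<bar>u $ j - w $ j\<bar>)" by (intro sum_nonneg) auto
    ultimately have "nat (\<Sum>j\<in>UNIV. \<bar>u $ j - w $ j\<bar>) < nat (\<Sum>j\<in>UNIV. \<bar>v $ j - w $ j\<bar>)"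
      by (simp only: nat_less_eq_zless)
    then have "w \<in> open_cluster lattice_edges u" by (rule less)
    moreover have "u \<in> open_cluster lattice_edges v"
      using open_cluster_step[OF open_cluster_refl uv] .
    ultimately show ?thesis using open_cluster_trans by blast
  qed simp
qed

text \<open>The balls are cumulative, so a path of exactly \<open>n\<close> steps is guaranteed only
  for the least \<open>n\<close>.\<close>

lemma reach_path:
  assumes "w \<in> reach B n v" "\<And>j. j < n \<Longrightarrow> w \<notin> reach B j v"
  obtains p where "p 0 = v" "p n = w" "\<And>i. i < n \<Longrightarrow> {p i, p (Suc i)} \<in> B"
  using assms
proof (induction n arbitrary: w thesis)
  case 0
  show ?case by (rule 0(1)[of "\<lambda>_. v"]) (use 0 in auto)
next
  case (Suc n)
  have "w \<notin> reach B n v" using Suc.prems by simp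
  then obtain u where u: "u \<in> reach B n v" "{u, w} \<in> B" using Suc.prems(2) by auto
  have "u \<notin> reach B j v" if "j < n" for j
  proof
    assume "u \<in> reach B j v"
    then have "w \<in> reach B (Suc j) v" using u by auto
    then show False using Suc.prems(3)[of "Suc j"] that by simp
  qed
  then obtain p where p: "p 0 = v" "p n = u" "\<And>i. i < n \<Longrightarrow> {p i, p (Suc i)} \<in> B"
    using Suc.IH[OF _ u(1)] by blast
  show ?case
    by (rule Suc.prems(1)[of "p(Suc n := w)"]) (use p u(2) in \<open>auto simp: less_Suc_eq\<close>)
qed

lemma path_reach:
  assumes "\<And>i. i < n \<Longrightarrow> {p i, p (Suc i)} \<in> B" "i \<le> j" "j \<le> n"
  shows "p j \<in> reach B (j - i) (p i)"
  using assms(2,3)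
proof (induction j)
  case (Suc j)
  show ?case
  proof (cases "i = Suc j")
    case False
    then have "p j \<in> reach B (j - i) (p i)" using Suc by auto
    moreover have "{p j, p (Suc j)} \<in> B" using assms(1) Suc by auto
    ultimately have "p (Suc j) \<in> reach B (Suc (j - i)) (p i)" by auto
    then show ?thesis using False Suc by (simp add: Suc_diff_le)
  qed simp
qed simp

text \<open>All properties follow from minimality: a repeated vertex, a return to \<open>C\<close>
  or an early visit to \<open>I\<close> would give a shorter connection. The path runs in the full
  lattice, whatever is open.\<close>

lemma shortest_lattice_path:
  fixes C I :: "(int ^ 'd) set"
  assumes "C \<noteq> {}" "I \<noteq> {}" "C \<inter> I = {}"
  obtains p n where "n > 0" "p 0 \<in> C" "p n \<in> I"
    "\<And>i. i < n \<Longrightarrow> {p i, p (Suc i)} \<in> lattice_edges"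
    "inj_on p {..n}" "\<And>i. 0 < i \<Longrightarrow> i \<le> n \<Longrightarrow> p i \<notin> C" "\<And>i. i < n \<Longrightarrow> p i \<notin> I"
proof -
  define Q where "Q n \<longleftrightarrow> (\<exists>x\<in>C. \<exists>w\<in>I. w \<in> reach lattice_edges n x)" for n
  define n where "n = (LEAST n. Q n)"
  obtain a b where ab: "a \<in> C" "b \<in> I" using assms by blast
  have "\<exists>n. b \<in> reach lattice_edges n a"
    using open_cluster_lattice[of b a] unfolding open_cluster_reach by blast
  then have "\<exists>n. Q n" unfolding Q_def using ab by blast
  then have Qn: "Q n" unfolding n_def by (rule LeastI_ex)
  have min: "n \<le> m" if "x \<in> C" "w \<in> I" "w \<in> reach lattice_edges m x" for x w m
    unfolding n_def using that by (intro Least_le) (auto simp: Q_def)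
  obtain x w where xw: "x \<in> C" "w \<in> I" "w \<in> reach lattice_edges n x" using Qn Q_def by blast
  have "w \<notin> reach lattice_edges j x" if "j < n" for j using min[OF xw(1,2)] that leD by blast
  then obtain p where p: "p 0 = x" "p n = w" "\<And>i. i < n \<Longrightarrow> {p i, p (Suc i)} \<in> lattice_edges"
    using reach_path[OF xw(3)] by blast
  have pr: "p j \<in> reach lattice_edges (j - i) (p i)" if "i \<le> j" "j \<le> n" for i j
    by (rule path_reach[where p = p and n = n and B = lattice_edges, OF p(3) that])
  show thesis
  proof (rule that[of n p])
    show "n > 0"
    proof (rule ccontr)
      assume "\<not> n > 0"
      then show False using xw assms p by auto
    qed
    show "inj_on p {..n}"
    proof -
      have "p i \<noteq> p j" if "i < j" "j \<le> n" for i j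
      proof
        assume eq: "p i = p j"
        \<comment> \<open>The loop from \<open>p i\<close> to \<open>p j\<close> is cut out.\<close>
        have "w \<in> reach lattice_edges ((i - 0) + (n - j)) (p 0)"
          using reach_trans[OF pr[of 0 i] , of w "n - j"] pr[of j n] that eq p by simp
        then show False using min[of x w "i + (n - j)"] xw p that by simp
      qed
      then show ?thesis unfolding inj_on_def by (metis atMost_iff linorder_neqE_nat)
    qed
    show "p i \<notin> C" if "0 < i" "i \<le> n" for i
      using min[of "p i" w "n - i"] pr[of i n] xw p that by fastforce
    show "p i \<notin> I" if "i < n" for i
      using min[of x "p i" i] pr[of 0 i] xw p that by fastforce
  qed (use p xw in auto)
qed

section \<open>Nearest targets, and sets with a single gate\<close>

definition nearest :: "(int ^ 'd) set set \<Rightarrow> (int ^ 'd) set \<Rightarrow> int ^ 'd \<Rightarrow> (int ^ 'd) set" where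
  "nearest B I v = {z \<in> I. \<exists>n. z \<in> reach B n v \<and> (\<forall>j<n. reach B j v \<inter> I = {})}"

lemma nearest_eq_reach:
  assumes "z \<in> nearest B I v"
  obtains n where "nearest B I v = reach B n v \<inter> I"
proof -
  obtain n where n: "z \<in> I" "z \<in> reach B n v" "\<forall>j<n. reach B j v \<inter> I = {}"
    using assms unfolding nearest_def by blast
  have "nearest B I v = reach B n v \<inter> I"
  proof (intro equalityI subsetI)
    fix y assume "y \<in> nearest B I v"
    then obtain m where m: "y \<in> I" "y \<in> reach B m v" "\<forall>j<m. reach B j v \<inter> I = {}"
      unfolding nearest_def by blast
    then have "m = n" using n by (metis disjoint_iff linorder_neqE_nat)
    then show "y \<in> reach B n v \<inter> I" using m by blast
  qed (use n in \<open>auto simp: nearest_def\<close>)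
  then show ?thesis by (rule that)
qed

lemma finite_nearest: "B \<subseteq> lattice_edges \<Longrightarrow> finite (nearest B I v)"
  by (metis ex_in_conv finite.emptyI finite_Int finite_reach nearest_eq_reach)

lemma nearest_nonempty:
  assumes "open_cluster B v \<inter> I \<noteq> {}"
  shows "nearest B I v \<noteq> {}"
proof -
  define n where "n = (LEAST n. reach B n v \<inter> I \<noteq> {})"
  have "\<exists>n. reach B n v \<inter> I \<noteq> {}" using assms unfolding open_cluster_reach by blast
  then have "reach B n v \<inter> I \<noteq> {}" unfolding n_def by (rule LeastI_ex)
  moreover have "\<forall>j<n. reach B j v \<inter> I = {}" unfolding n_def using not_less_Least by blast
  ultimately show ?thesis unfolding nearest_def by blast
qed

text \<open>Every way out of \<open>K\<close> passes through \<open>x\<close>. Distances from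
  \<open>v\<close> to vertices outside \<open>K\<close> therefore exceed those from \<open>x\<close>
  by the constant \<open>d\<close>, the distance from \<open>v\<close> to \<open>x\<close>. All
  targets lie outside \<open>K\<close>, so the minimisers agree.\<close>

lemma nearest_through_gate:
  assumes x: "x \<in> K" and KI: "K \<inter> I = {}" and v: "v \<in> K" "x \<in> open_cluster B v"
    and gate: "\<And>u w. u \<in> K \<Longrightarrow> w \<notin> K \<Longrightarrow> {u, w} \<in> B \<Longrightarrow> u = x"
  shows "nearest B I v = nearest B I x"
proof -
  define d where "d = (LEAST n. x \<in> reach B n v)"
  have "\<exists>n. x \<in> reach B n v" using v unfolding open_cluster_reach by blast
  then have d: "x \<in> reach B d v" unfolding d_def by (rule LeastI_ex)
  have d_le: "d \<le> n" if "x \<in> reach B n v" for n unfolding d_def using that by (rule Least_le)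
  have split: "w \<in> reach B n v \<longleftrightarrow> d \<le> n \<and> w \<in> reach B (n - d) x" if "w \<notin> K" for w n
  proof
    show "w \<in> reach B n v \<Longrightarrow> d \<le> n \<and> w \<in> reach B (n - d) x"
      using that
    proof (induction n arbitrary: w)
      case 0
      then show ?case using v by auto
    next
      case (Suc n)
      show ?case
      proof (cases "w \<in> reach B n v")
        case True
        then have "d \<le> n" "w \<in> reach B (n - d) x" using Suc by auto
        moreover from this have "n - d \<le> Suc n - d" by linarith
        ultimately show ?thesis using reach_mono[of "n - d" "Suc n - d" B x] by auto
      next
        case False
        then obtain u where u: "u \<in> reach B n v" "{u, w} \<in> B" using Suc.prems by auto
        show ?thesis
        proof (cases "u \<in> K")
          case True
          \<comment> \<open>The step from \<open>u\<close> to \<open>w\<close> leaves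
            \<open>K\<close>, so it starts at the gate, which is at distance \<open>d\<close> from
            \<open>v\<close>.\<close>
          then have ux: "u = x" using gate u Suc.prems by blast
          then have dn: "d \<le> n" using d_le u by blast
          have "w \<in> reach B 1 x" using u ux by auto
          moreover have "1 \<le> Suc n - d" using dn by linarith
          ultimately have "w \<in> reach B (Suc n - d) x" by (rule rev_subsetD[OF _ reach_mono])
          then show ?thesis using dn by simp
        next
          case False
          then have "d \<le> n" "u \<in> reach B (n - d) x" using Suc.IH u by auto
          then show ?thesis using u by (auto simp: Suc_diff_le)
        qed
      qed
    qed
    show "d \<le> n \<and> w \<in> reach B (n - d) x \<Longrightarrow> w \<in> reach B n v"
      using reach_trans[OF d, of w "n - d"] by auto
  qed
  have avoid: "reach B n v \<inter> I = {} \<longleftrightarrow> (d \<le> n \<longrightarrow> reach B (n - d) x \<inter> I = {})" for n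
    using split KI by blast
  have "z \<in> nearest B I v \<longleftrightarrow> z \<in> nearest B I x" for z
  proof
    assume "z \<in> nearest B I v"
    then obtain n where n: "z \<in> I" "z \<in> reach B n v" "\<forall>j<n. reach B j v \<inter> I = {}"
      unfolding nearest_def by blast
    have "d \<le> n" "z \<in> reach B (n - d) x" using split[of z n] n KI by auto
    moreover have "reach B j x \<inter> I = {}" if "j < n - d" for j
      using n(3) avoid[of "d + j"] that by auto
    ultimately show "z \<in> nearest B I x" using n unfolding nearest_def by blast
  next
    assume "z \<in> nearest B I x"
    then obtain m where m: "z \<in> I" "z \<in> reach B m x" "\<forall>j<m. reach B j x \<inter> I = {}"
      unfolding nearest_def by blast
    have "z \<in> reach B (d + m) v" using reach_trans[OF d m(2)] .
    moreover have "reach B j v \<inter> I = {}" if "j < d + m" for j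
      using m(3) avoid[of j] that by auto
    ultimately show "z \<in> nearest B I v" using m unfolding nearest_def by blast
  qed
  then show ?thesis by blast
qed

section \<open>Surgeries whose effect does not spread\<close>

text \<open>\<open>H\<close> is closed by delay and \<open>P\<close> is forced open after
  \<open>r\<close>; no other edge may change its state by time \<open>t\<close>. The induction along
  the new clocks has three cases. An edge of \<open>P\<close> opens because \<open>degree\<close>
  leaves too few competitors at its ends. Any other edge near \<open>X\<close> and outside
  \<open>H\<close> was open and still opens: its earlier open neighbours can only disappear, since a
  neighbour in \<open>P\<close> rings after \<open>r\<close> whereas by \<open>kept\<close> the edge
  itself rings by \<open>r\<close>. An edge further away sees the same neighbours as before, because
  edges of \<open>H\<close> off \<open>X\<close> were closed at time \<open>t\<close>
  anyway.\<close>

lemma local_modification: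
  assumes wf: "wf (earlier U)" "wf (earlier U')"
    and P: "P \<subseteq> lattice_edges" "\<Union> P \<subseteq> X" and HP: "H \<inter> P = {}"
    and same: "\<And>e. e \<in> lattice_edges \<Longrightarrow> e \<notin> H \<Longrightarrow> e \<notin> P \<Longrightarrow> U' e = U e"
    and late: "\<And>e. e \<in> H \<Longrightarrow> U' e > t"
    and P_time: "\<And>e. e \<in> P \<Longrightarrow> r < U' e" "\<And>e. e \<in> P \<Longrightarrow> U' e \<le> t"
    and kept: "\<And>e. e \<in> lattice_edges \<Longrightarrow> e \<inter> X \<noteq> {} \<Longrightarrow> e \<notin> H \<Longrightarrow> e \<notin> P \<Longrightarrow> e \<in> open_by k U r"
    and near: "\<And>e f. e \<in> lattice_edges \<Longrightarrow> f \<in> lattice_edges \<Longrightarrow> e \<inter> f \<noteq> {} \<Longrightarrow> f \<inter> X \<noteq> {} \<Longrightarrow>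
      e \<notin> H \<Longrightarrow> e \<notin> P \<Longrightarrow> e \<in> open_by k U t"
    and far: "\<And>e. e \<in> H \<Longrightarrow> e \<inter> X = {} \<Longrightarrow> e \<notin> open_by k U t"
    and degree: "\<And>e v. e \<in> P \<Longrightarrow> v \<in> e \<Longrightarrow> card {x. {x, v} \<in> lattice_edges - H - {e}} < k"
    and "r < t"
  shows "open_by k U' t = (open_by k U t - H - P) \<union> P"
    and "s \<le> r \<Longrightarrow> open_by k U' s = open_by k U s - H - P"
proof -
  define Q where "Q = (open_by k U t - H - P) \<union> P"
  \<comment> \<open>The restriction to clocks up to \<open>t\<close> passes to all earlier edges, so
    it survives the induction.\<close>
  have key: "U' e \<le> t \<Longrightarrow> e \<in> opened k U' \<longleftrightarrow> e \<in> Q" for e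
    using wf(2)
  proof (induction e rule: wf_induct_rule)
    case (less e)
    show ?case
    proof (cases "e \<in> lattice_edges")
      case False
      then show ?thesis using opened_lattice[of k U'] open_by_lattice[of k U t] P unfolding Q_def by blast
    next
      case True
      then have eH: "e \<notin> H" using late less.prems by (meson not_less)
      have opened: "e \<in> opened k U' \<longleftrightarrow>
          (\<forall>v\<in>e. card {x. {x, v} \<in> opened k U' \<and> U' {x, v} < U' e} < k)"
        using opened_iff[OF wf(2), of e k] True unfolding admissible_def by simp
      have D: "{x. {x, v} \<in> opened k U' \<and> U' {x, v} < U' e} = {x. {x, v} \<in> Q \<and> U' {x, v} < U' e}"
        if "v \<in> e" for v
      proof -
        have "{x, v} \<in> opened k U' \<longleftrightarrow> {x, v} \<in> Q" if "U' {x, v} < U' e" for x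
        proof (cases "{x, v} \<in> lattice_edges")
          case False
          then show ?thesis
            using opened_lattice[of k U'] open_by_lattice[of k U t] P unfolding Q_def by blast
        next
          case xv: True
          have "({x, v}, e) \<in> earlier U'"
            using xv True \<open>v \<in> e\<close> that unfolding earlier_def adjacent_edges_def by auto
          then show ?thesis using less.IH less.prems that by auto
        qed
        then show ?thesis by blast
      qed
      have fin: "finite {x. {x, v} \<in> S}" if "S \<subseteq> lattice_edges" for v and S :: "(int ^ 'a) set set"
        by (rule finite_subset[OF _ finite_neighbours[of v]]) (use that in auto)
      show ?thesis
      proof (cases "e \<in> P")
        case True
        have "card {x. {x, v} \<in> Q \<and> U' {x, v} < U' e} < k" if "v \<in> e" for v
        proof -
          have "card {x. {x, v} \<in> Q \<and> U' {x, v} < U' e} \<le> card {x. {x, v} \<in> lattice_edges - H - {e}}"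
            by (rule card_mono[OF fin]) (use open_by_lattice[of k U t] P HP in \<open>auto simp: Q_def\<close>)
          also have "\<dots> < k" using degree[OF True that] .
          finally show ?thesis .
        qed
        then show ?thesis using D opened True unfolding Q_def by auto
      next
        case False
        have Ue: "U' e = U e" using same[OF True eH False] .
        have openedU: "e \<in> opened k U \<longleftrightarrow> (\<forall>v\<in>e. card {x. {x, v} \<in> opened k U \<and> U {x, v} < U e} < k)"
          using opened_iff[OF wf(1), of e k] True unfolding admissible_def by simp
        have eQ: "e \<in> Q \<longleftrightarrow> e \<in> opened k U"
          using eH False less.prems Ue unfolding Q_def open_by_def by auto
        show ?thesis
        proof (cases "\<exists>f\<in>lattice_edges. e \<inter> f \<noteq> {} \<and> f \<inter> X \<noteq> {}")
          case True
          then have eo: "e \<in> opened k U"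
            using near[OF \<open>e \<in> lattice_edges\<close> _ _ _ eH False] unfolding open_by_def by blast
          have "card {x. {x, v} \<in> Q \<and> U' {x, v} < U' e} < k" if v: "v \<in> e" for v
          proof -
            have "{x. {x, v} \<in> Q \<and> U' {x, v} < U' e} \<subseteq> {x. {x, v} \<in> opened k U \<and> U {x, v} < U e}"
            proof
              fix x assume "x \<in> {x. {x, v} \<in> Q \<and> U' {x, v} < U' e}"
              then have x: "{x, v} \<in> Q" "U' {x, v} < U' e" by auto
              have "{x, v} \<notin> P"
              proof
                assume xP: "{x, v} \<in> P"
                then have "v \<in> X" using P by auto
                then have "e \<inter> X \<noteq> {}" using v by blast
                then have "U e \<le> r" using kept[OF \<open>e \<in> lattice_edges\<close> _ eH False]
                  unfolding open_by_def by blast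
                then show False using P_time(1)[OF xP] x Ue by simp
              qed
              then have "{x, v} \<in> open_by k U t" "{x, v} \<notin> H" "{x, v} \<notin> P"
                using x unfolding Q_def by auto
              then show "x \<in> {x. {x, v} \<in> opened k U \<and> U {x, v} < U e}"
                using same[of "{x, v}"] open_by_lattice[of k U t] x Ue
                unfolding open_by_def by auto
            qed
            then have "card {x. {x, v} \<in> Q \<and> U' {x, v} < U' e} \<le>
                card {x. {x, v} \<in> opened k U \<and> U {x, v} < U e}"
              by (intro card_mono finite_subset[OF _ finite_neighbours[of v]])
                (use opened_lattice in auto)
            then show ?thesis using eo openedU v by fastforce
          qed
          then show ?thesis using D opened eQ eo by auto
        next
          case nofar: False
          have "{x, v} \<in> Q \<and> U' {x, v} < U' e \<longleftrightarrow> {x, v} \<in> opened k U \<and> U {x, v} < U e"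
            if v: "v \<in> e" for x v
          proof (cases "{x, v} \<in> lattice_edges")
            case False
            then show ?thesis
              using opened_lattice[of k U] open_by_lattice[of k U t] P unfolding Q_def by blast
          next
            case xv: True
            have ev: "e \<inter> {x, v} \<noteq> {}" using v by auto
            have xvX: "{x, v} \<inter> X = {}"
            proof (rule ccontr)
              assume "{x, v} \<inter> X \<noteq> {}"
              with ev have "e \<inter> {x, v} \<noteq> {} \<and> {x, v} \<inter> X \<noteq> {}" by (rule conjI)
              then have "\<exists>f\<in>lattice_edges. e \<inter> f \<noteq> {} \<and> f \<inter> X \<noteq> {}" using xv by (rule bexI)
              with nofar show False by (rule notE)
            qed
            have xvP: "{x, v} \<notin> P"
            proof
              assume "{x, v} \<in> P"
              then have "{x, v} \<subseteq> \<Union> P" by (rule Union_upper)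
              then have "{x, v} \<subseteq> X" using P(2) by (rule order.trans)
              then show False using xvX by simp
            qed
            show ?thesis
            proof (cases "{x, v} \<in> H")
              case True
              then have "{x, v} \<notin> open_by k U t" using far xvX by blast
              then show ?thesis
                using True xvP less.prems Ue HP unfolding Q_def open_by_def by auto
            next
              case False
              then show ?thesis
                using same[OF xv False xvP] xvP less.prems Ue unfolding Q_def open_by_def by auto
            qed
          qed
          then have "{x. {x, v} \<in> Q \<and> U' {x, v} < U' e} = {x. {x, v} \<in> opened k U \<and> U {x, v} < U e}"
            if "v \<in> e" for v using that by blast
          then show ?thesis using D opened openedU eQ by auto
        qed
      qed
    qed
  qed
  have UQ: "U' e \<le> t" if "e \<in> Q" for e
  proof (cases "e \<in> P")
    case False
    then have e: "e \<in> open_by k U t" "e \<notin> H" using that unfolding Q_def by auto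
    then have "U' e = U e" using same False open_by_lattice by blast
    then show ?thesis using e unfolding open_by_def by simp
  qed (use P_time in auto)
  show A: "open_by k U' t = (open_by k U t - H - P) \<union> P"
    unfolding Q_def[symmetric] using key UQ unfolding open_by_def by blast
  assume s: "s \<le> r"
  have "open_by k U' s = {e \<in> open_by k U' t. U' e \<le> s}"
    using s \<open>r < t\<close> unfolding open_by_def by auto
  also have "\<dots> = {e \<in> open_by k U t - H - P. U' e \<le> s}"
    unfolding A using P_time(1) s by fastforce
  also have "\<dots> = {e \<in> open_by k U t - H - P. U e \<le> s}"
    using same open_by_lattice[of k U t] by force
  also have "\<dots> = open_by k U s - H - P"
    using s \<open>r < t\<close> unfolding open_by_def by auto
  finally show "open_by k U' s = open_by k U s - H - P" .
qed

section \<open>Attaching a cluster to an earlier infinite cluster\<close>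

text \<open>Of two open edges at \<open>v\<close>, the later one would have found \<open>v\<close>
  saturated. Injectivity of the clocks excludes a tie.\<close>

lemma degree_one:
  assumes wf: "wf (earlier U)" and inj: "inj_on U lattice_edges"
  shows "card {x. {x, v} \<in> open_by 1 U t} \<le> 1"
proof (rule ccontr)
  let ?N = "{x. {x, v} \<in> open_by 1 U t}"
  have fin: "finite ?N"
    by (rule finite_subset[OF _ finite_neighbours[of v]]) (use open_by_lattice in auto)
  assume "\<not> card ?N \<le> 1"
  then obtain x y where xy: "x \<in> ?N" "y \<in> ?N" "x \<noteq> y"
    using fin by (metis card_le_Suc0_iff_eq One_nat_def)
  have *: "\<not> U {b, v} < U {a, v}" if "a \<in> ?N" "b \<in> ?N" for a b
  proof
    assume less: "U {b, v} < U {a, v}"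
    have "{a, v} \<in> opened 1 U" using that unfolding open_by_def by simp
    then have "card {x. {x, v} \<in> opened 1 U \<and> U {x, v} < U {a, v}} < 1"
      using opened_iff[OF wf] unfolding admissible_def by blast
    moreover have "finite {x. {x, v} \<in> opened 1 U \<and> U {x, v} < U {a, v}}"
      by (rule finite_subset[OF _ finite_neighbours[of v]]) (use opened_lattice in auto)
    moreover have "b \<in> {x. {x, v} \<in> opened 1 U \<and> U {x, v} < U {a, v}}"
      using less that unfolding open_by_def by simp
    ultimately show False by (auto simp: card_eq_0_iff)
  qed
  have "U {x, v} = U {y, v}" using *[OF xy(1,2)] *[OF xy(2,1)] by simp
  moreover have "{x, v} \<in> lattice_edges" "{y, v} \<in> lattice_edges"
    using xy open_by_lattice by auto
  ultimately have "{x, v} = {y, v}" using inj by (meson inj_onD)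
  then show False using xy by (auto simp: doubleton_eq_iff)
qed

lemma finite_cluster_later:
  assumes "finite (open_cluster (open_by k U t) v)"
  shows "\<exists>n. finite (open_cluster (open_by k U (t + 1 / Suc n)) v)"
proof -
  define C where "C = open_cluster (open_by k U t) v"
  \<comment> \<open>Boundary edges that ever open. Their clocks exceed \<open>t\<close>, and
    finitely many clocks leave a common gap after \<open>t\<close>.\<close>
  define F where "F = {e \<in> opened k U. \<exists>u w. e = {u, w} \<and> u \<in> C \<and> w \<notin> C}"
  have "F \<subseteq> (\<lambda>(u, w). {w, u}) ` (SIGMA u:C. {w. {w, u} \<in> lattice_edges})"
    unfolding F_def using opened_lattice[of k U]
    by (force simp: insert_commute)
  moreover have "finite ((\<lambda>(u, w). {w, u}) ` (SIGMA u:C. {w. {w, u} \<in> lattice_edges}))"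
    using assms finite_neighbours unfolding C_def[symmetric] by (intro finite_imageI finite_SigmaI)
  ultimately have "finite F" by (rule finite_subset)
  moreover have "\<forall>\<^sub>F n in sequentially. t + 1 / Suc n < U e" if e: "e \<in> F" for e
  proof -
    obtain u w where uw: "e = {u, w}" "u \<in> C" "w \<notin> C" "e \<in> opened k U"
      using e unfolding F_def by blast
    have "\<not> U e \<le> t"
    proof
      assume "U e \<le> t"
      then have "{u, w} \<in> open_by k U t" using uw unfolding open_by_def by simp
      then show False using open_cluster_step uw unfolding C_def by blast
    qed
    then have "t + 0 < U e" by simp
    moreover have "(\<lambda>n. t + 1 / Suc n) \<longlonglongrightarrow> t + 0"
      by (intro tendsto_add tendsto_const LIMSEQ_Suc[OF lim_1_over_n])
    ultimately show ?thesis by (rule order_tendstoD(2)[rotated])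
  qed
  ultimately have "\<forall>\<^sub>F n in sequentially. \<forall>e\<in>F. t + 1 / Suc n < U e"
    by (intro eventually_ball_finite) auto
  then obtain n where n: "\<forall>e\<in>F. t + 1 / Suc n < U e"
    unfolding eventually_sequentially by blast
  have "open_cluster (open_by k U (t + 1 / Suc n)) v \<subseteq> C"
  proof (rule open_cluster_subset)
    show "v \<in> C" unfolding C_def by simp
    fix u w assume u: "u \<in> C" and uw: "{u, w} \<in> open_by k U (t + 1 / Suc n)"
    show "w \<in> C"
    proof (rule ccontr)
      assume "w \<notin> C"
      then have "{u, w} \<in> F" using u uw unfolding F_def open_by_def by blast
      then show False using n uw unfolding open_by_def by fastforce
    qed
  qed
  then show ?thesis using assms finite_subset unfolding C_def by blast
qed

text \<open>A connecting path has finitely many clocks, none equal to \<open>t\<close>, so it is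
  complete at some time before \<open>t\<close>.\<close>

lemma open_cluster_earlier:
  assumes ne: "\<And>e. e \<in> lattice_edges \<Longrightarrow> U e \<noteq> t" and w: "w \<in> open_cluster (open_by k U t) v"
  shows "\<exists>s<t. w \<in> open_cluster (open_by k U s) v"
proof -
  have "(\<lambda>x y. {x, y} \<in> open_by k U t)\<^sup>*\<^sup>* v w" using w unfolding open_cluster_def by simp
  then show ?thesis
  proof (induction rule: rtranclp_induct)
    case base
    show ?case by (rule exI[of _ "t - 1"]) simp
  next
    case (step y z)
    then obtain s where s: "s < t" "y \<in> open_cluster (open_by k U s) v" by blast
    define s' where "s' = max s (U {y, z})"
    have "U {y, z} \<le> t" "{y, z} \<in> lattice_edges" "{y, z} \<in> opened k U"
      using step open_by_lattice opened_lattice unfolding open_by_def by auto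
    then have "s' < t" "{y, z} \<in> open_by k U s'"
      using s ne[of "{y, z}"] unfolding s'_def open_by_def by auto
    moreover have "y \<in> open_cluster (open_by k U s') v"
      using s open_cluster_mono[OF open_by_mono[of s s' k U], of v] unfolding s'_def by auto
    ultimately show ?case using open_cluster_step by blast
  qed
qed

text \<open>If \<open>w\<close> percolated at time \<open>s\<close>, then \<open>v\<close> would
  percolate once it is joined to \<open>w\<close>, and this happens before \<open>t\<close>. So a
  failure of left continuity produces a cluster at time \<open>t\<close> that avoids all vertices
  percolating at \<open>s\<close>.\<close>

lemma no_earlier_infinite_cluster:
  assumes ne: "\<And>e. e \<in> lattice_edges \<Longrightarrow> U e \<noteq> t"
    and fin: "\<And>s. s < t \<Longrightarrow> finite (open_cluster (open_by k U s) v)"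
    and w: "w \<in> open_cluster (open_by k U t) v" and s: "s < t"
  shows "finite (open_cluster (open_by k U s) w)"
proof -
  obtain s' where s': "s' < t" "w \<in> open_cluster (open_by k U s') v"
    using open_cluster_earlier[OF ne w] by blast
  define s'' where "s'' = max s s'"
  have "w \<in> open_cluster (open_by k U s'') v"
    using s' open_cluster_mono[OF open_by_mono[of s' s'' k U], of v] unfolding s''_def by auto
  then have "open_cluster (open_by k U s'') w = open_cluster (open_by k U s'') v"
    by (rule open_cluster_eq)
  moreover have "open_cluster (open_by k U s) w \<subseteq> open_cluster (open_by k U s'') w"
    by (intro open_cluster_mono open_by_mono) (simp add: s''_def)
  moreover have "s'' < t" using s s' unfolding s''_def by simp
  ultimately show ?thesis using fin[of s''] finite_subset by metis
qed

section \<open>The surgery along a shortest path\<close>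

definition percolating :: "(int ^ 'd) set set \<Rightarrow> (int ^ 'd) set" where
  "percolating B = {v. infinite (open_cluster B v)}"

lemma percolating_mono: "B \<subseteq> B' \<Longrightarrow> percolating B \<subseteq> percolating B'"
  unfolding percolating_def by (auto dest: finite_subset[OF open_cluster_mono])

text \<open>Clocks are pushed by affine maps into \<open>[r, t]\<close> and \<open>[t, 1]\<close>
  instead of being drawn anew. No second source of randomness appears, and almost sure properties
  carry over (\<open>AE_resample\<close>).\<close>

definition resample ::
    "'e set \<Rightarrow> 'e set \<Rightarrow> real \<Rightarrow> real \<Rightarrow> ('e \<Rightarrow> real) \<Rightarrow> 'e \<Rightarrow> real" where
  "resample H P r t U e =
     (if e \<in> P then r + (t - r) * U e else if e \<in> H then t + (1 - t) * U e else U e)"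

text \<open>\<open>X\<close> is the vertex set of a shortest lattice path from \<open>x\<close> in
  the cluster \<open>C\<close> to \<open>y\<close> in the set \<open>I\<close> percolating at
  \<open>s\<close>. At \<open>X\<close> only the path and two old edges \<open>{x, c}\<close> and
  \<open>{y, c'}\<close> survive, each leading to an infinite piece off \<open>X\<close>. The
  infinite set \<open>K\<close> then hangs on the gate \<open>x\<close>. The conclusion records just
  what the mass transport sees, a common nonempty set of nearest targets. Assumption
  \<open>wf'\<close> covers all surgeries because the one in question is chosen inside the
  proof.\<close>

lemma attach_cluster:
  assumes k: "k \<ge> 2" and st: "s < t" "t < 1"
    and wf: "wf (earlier U)"
    and clock: "\<And>e. e \<in> lattice_edges \<Longrightarrow> 0 < U e \<and> U e \<le> 1 \<and> U e \<noteq> t"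
    and wf': "\<And>H P r. finite H \<Longrightarrow> finite P \<Longrightarrow> H \<union> P \<subseteq> lattice_edges \<Longrightarrow> r \<in> \<rat> \<Longrightarrow> s < r \<Longrightarrow> r < t \<Longrightarrow>
      wf (earlier (resample H P r t U))"
    and C: "infinite (open_cluster (open_by k U t) v)"
      "open_cluster (open_by k U t) v \<inter> percolating (open_by k U s) = {}"
    and I: "percolating (open_by k U s) \<noteq> {}"
  obtains H P r K x z where "finite H" "finite P" "H \<union> P \<subseteq> lattice_edges" "r \<in> \<rat>" "s < r" "r < t"
    "infinite K"
    "z \<in> nearest (open_by k (resample H P r t U) t) (percolating (open_by k (resample H P r t U) s)) x"
    "\<And>u. u \<in> K \<Longrightarrow> nearest (open_by k (resample H P r t U) t) (percolating (open_by k (resample H P r t U) s)) u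
      = nearest (open_by k (resample H P r t U) t) (percolating (open_by k (resample H P r t U) s)) x"
proof -
  define B where "B = open_by k U t"
  define S where "S = open_by k U s"
  define C where "C = open_cluster B v"
  define I where "I = percolating S"
  have BL: "B \<subseteq> lattice_edges" and SL: "S \<subseteq> lattice_edges" and SB: "S \<subseteq> B"
    using st open_by_lattice open_by_mono[of s t k U] unfolding B_def S_def by auto
  have CI: "C \<inter> I = {}" and infC: "infinite C" and I0: "I \<noteq> {}"
    using assms unfolding C_def I_def B_def S_def by auto
  have "C \<noteq> {}" unfolding C_def using open_cluster_refl by blast
  from shortest_lattice_path[OF this I0 CI] obtain p n where n: "n > 0" and p0: "p 0 \<in> C" and pn: "p n \<in> I"
    and pL: "\<And>i. i < n \<Longrightarrow> {p i, p (Suc i)} \<in> lattice_edges" and inj: "inj_on p {..n}"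
    and pC: "\<And>i. 0 < i \<Longrightarrow> i \<le> n \<Longrightarrow> p i \<notin> C" and pI: "\<And>i. i < n \<Longrightarrow> p i \<notin> I"
    by metis
  define x where "x = p 0"
  define y where "y = p n"
  define X where "X = p ` {..n}"
  define P where "P = (\<lambda>i. {p i, p (Suc i)}) ` {..<n}"
  have x: "x \<in> C" "x \<in> X" and y: "y \<in> I" "y \<in> X"
    using p0 pn unfolding x_def y_def X_def by auto
  have XC: "u = x" if "u \<in> X" "u \<in> C" for u
  proof -
    obtain i where i: "i \<le> n" "u = p i" using \<open>u \<in> X\<close> unfolding X_def by auto
    then have "i = 0" using pC[of i] \<open>u \<in> C\<close> by (cases i) auto
    then show ?thesis using i unfolding x_def by simp
  qed
  have XI: "u = y" if "u \<in> X" "u \<in> I" for u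
  proof -
    obtain i where i: "i \<le> n" "u = p i" using \<open>u \<in> X\<close> unfolding X_def by auto
    then have "i = n" using pI[of i] \<open>u \<in> I\<close> by (metis le_neq_implies_less)
    then show ?thesis using i unfolding y_def by simp
  qed
  have PL: "P \<subseteq> lattice_edges" and PX: "\<Union> P \<subseteq> X" and finP: "finite P"
    using pL unfolding P_def X_def by auto

  have Cx: "open_cluster B x = C" using x open_cluster_eq unfolding C_def by blast
  then have "infinite (open_cluster B x)" using infC by simp
  then obtain c where c: "{x, c} \<in> B" and infc: "infinite (open_cluster {e \<in> B. x \<notin> e} c)"
    using infinite_branch[OF BL] by blast
  have cC: "c \<in> C" using open_cluster_step[OF open_cluster_refl c] Cx by simp
  have "infinite (open_cluster S y)" using y unfolding I_def percolating_def by simp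
  then obtain c' where c': "{y, c'} \<in> S" and infc': "infinite (open_cluster {e \<in> S. y \<notin> e} c')"
    using infinite_branch[OF SL] by blast
  have SI: "u \<in> I" if "u \<in> open_cluster S w" "w \<in> I" for u w
    using open_cluster_eq[OF that(1)] that(2) unfolding I_def percolating_def by simp
  have c'I: "c' \<in> I" using open_cluster_step[OF open_cluster_refl c'] SI y by blast
  have cX: "c \<notin> X" using XC[OF _ cC] c BL no_loop by fastforce
  have c'X: "c' \<notin> X" using XI[OF _ c'I] c' SL no_loop by fastforce
  have KC: "open_cluster {e \<in> B. x \<notin> e} c \<subseteq> C"
  proof -
    have "open_cluster {e \<in> B. x \<notin> e} c \<subseteq> open_cluster B c" by (rule open_cluster_mono) auto
    also have "\<dots> = C" using cC open_cluster_eq unfolding C_def by blast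
    finally show ?thesis .
  qed
  have DI: "open_cluster {e \<in> S. y \<notin> e} c' \<subseteq> I"
  proof
    fix u assume "u \<in> open_cluster {e \<in> S. y \<notin> e} c'"
    then have "u \<in> open_cluster S c'"
      using open_cluster_mono[of "{e \<in> S. y \<notin> e}" S c'] by auto
    then show "u \<in> I" using SI c'I by blast
  qed

  \<comment> \<open>Closed edges near \<open>X\<close> are moved past \<open>t\<close> too: they might open once a neighbour is removed.\<close>
  define touch where "touch = {e \<in> lattice_edges. e \<inter> X \<noteq> {}}"
  define H where "H = {e \<in> touch. e \<notin> P \<and> e \<noteq> {x, c} \<and> e \<noteq> {y, c'}} \<union>
    {e \<in> lattice_edges. e \<notin> P \<and> e \<notin> B \<and> (\<exists>f\<in>touch. e \<inter> f \<noteq> {})}"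
  have fin_touch: "finite touch"
  proof (rule finite_subset)
    show "touch \<subseteq> (\<Union>v\<in>X. (\<lambda>w. {w, v}) ` {w. {w, v} \<in> lattice_edges})"
    proof
      fix e assume e: "e \<in> touch"
      then obtain a b where ab: "e = {a, b}" "{a, b} \<in> lattice_edges"
        using lattice_edgeE[of e] unfolding touch_def by blast
      have *: "e \<in> (\<lambda>w. {w, v}) ` {w. {w, v} \<in> lattice_edges}" if "e = {w, v}" for v w
        using that e unfolding touch_def by auto
      have "a \<in> X \<or> b \<in> X" using e ab unfolding touch_def by auto
      then show "e \<in> (\<Union>v\<in>X. (\<lambda>w. {w, v}) ` {w. {w, v} \<in> lattice_edges})"
      proof
        assume "a \<in> X"
        have "e = {b, a}" using ab by auto
        show ?thesis by (rule UN_I[OF \<open>a \<in> X\<close>]) (rule *[OF \<open>e = {b, a}\<close>])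
      next
        assume "b \<in> X"
        then show ?thesis by (rule UN_I) (rule *[OF ab(1)])
      qed
    qed
    show "finite (\<Union>v\<in>X. (\<lambda>w. {w, v}) ` {w. {w, v} \<in> lattice_edges})"
      using finite_neighbours unfolding X_def by auto
  qed
  have finH: "finite H"
  proof (rule finite_subset)
    show "H \<subseteq> touch \<union> (\<Union>f\<in>touch. adjacent_edges f)"
      unfolding H_def adjacent_edges_def by auto
    show "finite (touch \<union> (\<Union>f\<in>touch. adjacent_edges f))"
      using fin_touch finite_adjacent_edges unfolding touch_def by auto
  qed
  have HL: "H \<subseteq> lattice_edges" unfolding H_def touch_def by auto
  have HP: "H \<inter> P = {}" unfolding H_def by auto
  have cP: "{x, c} \<notin> P" "{y, c'} \<notin> P" using PX cX c'X by auto
  have cH: "{x, c} \<notin> H" "{y, c'} \<notin> H" using c c' SB unfolding H_def by auto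
  have BH: "e \<notin> H" if "e \<in> B" "e \<inter> X = {}" for e using that unfolding H_def touch_def by auto
  have PX': "e \<notin> P" if "u \<in> e" "u \<notin> X" for e u using that PX by auto

  \<comment> \<open>\<open>r\<close> must exceed the clock of \<open>{x, c}\<close>, so that this
    edge opens before every path edge; \<open>{y, c'}\<close> is open at time \<open>s\<close>
    already. A rational value keeps the number of surgeries countable.\<close>
  have "max s (U {x, c}) < t"
    using c clock[of "{x, c}"] BL st unfolding B_def open_by_def by fastforce
  then obtain r where r: "r \<in> \<rat>" "max s (U {x, c}) < r" "r < t" using Rats_dense_in_real by blast
  define U' where "U' = resample H P r t U"
  have wfU': "wf (earlier U')" unfolding U'_def using finH finP HL PL r by (intro wf') auto

  \<comment> \<open>A path vertex keeps only its predecessor and successor, with \<open>c\<close>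
    and \<open>c'\<close> in place of the missing ones at the two ends.\<close>
  have nb: "w \<in> {if i = 0 then c else p (i - 1), if i = n then c' else p (Suc i)}"
    if i: "i \<le> n" and w: "{w, p i} \<in> P \<or> {w, p i} = {x, c} \<or> {w, p i} = {y, c'}" for w i
    using w
  proof (elim disjE)
    assume "{w, p i} \<in> P"
    then obtain j where j: "j < n" "{w, p i} = {p j, p (Suc j)}" unfolding P_def by auto
    then consider "p i = p j" "w = p (Suc j)" | "p i = p (Suc j)" "w = p j"
      by (auto simp: doubleton_eq_iff)
    then show ?thesis
    proof cases
      case 1
      then have "i = j" using inj i j by (auto dest: inj_onD)
      then show ?thesis using 1 j by auto
    next
      case 2
      then have "i = Suc j" using inj i j by (auto dest: inj_onD)
      then show ?thesis using 2 by auto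
    qed
  next
    have pX: "p i \<in> X" using i unfolding X_def by auto
    assume "{w, p i} = {x, c}"
    then have "p i = x" "w = c" using pX cX by (auto simp: doubleton_eq_iff)
    then have "i = 0" using inj i unfolding x_def by (auto dest: inj_onD)
    then show ?thesis using \<open>w = c\<close> by simp
  next
    have pX: "p i \<in> X" using i unfolding X_def by auto
    assume "{w, p i} = {y, c'}"
    then have "p i = y" "w = c'" using pX c'X by (auto simp: doubleton_eq_iff)
    then have "i = n" using inj i unfolding y_def by (auto dest: inj_onD)
    then show ?thesis using \<open>w = c'\<close> by simp
  qed
  have U'_P: "U' e = r + (t - r) * U e" if "e \<in> P" for e
    using that unfolding U'_def resample_def by simp
  have U'_H: "U' e = t + (1 - t) * U e" if "e \<in> H" for e
    using that HP unfolding U'_def resample_def by auto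

  have mod: "open_by k U' t = (B - H - P) \<union> P"
    and mod': "open_by k U' s = S - H - P"
  proof -
    have same: "U' e = U e" if "e \<in> lattice_edges" "e \<notin> H" "e \<notin> P" for e
      using that unfolding U'_def resample_def by simp
    have late: "U' e > t" if "e \<in> H" for e
      using that clock[of e] HL st unfolding U'_H[OF that] by auto
    have P1: "r < U' e" if "e \<in> P" for e
      using that clock[of e] PL r unfolding U'_P[OF that] by auto
    have P2: "U' e \<le> t" if "e \<in> P" for e
    proof -
      have "(t - r) * U e \<le> (t - r) * 1"
        using that clock[of e] PL r by (intro mult_left_mono) auto
      then show ?thesis unfolding U'_P[OF that] by simp
    qed
    have kept: "e \<in> open_by k U r" if "e \<in> lattice_edges" "e \<inter> X \<noteq> {}" "e \<notin> H" "e \<notin> P" for e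
    proof -
      have "e = {x, c} \<or> e = {y, c'}" using that unfolding H_def touch_def by auto
      then show ?thesis
        using c c' r unfolding B_def S_def open_by_def by auto
    qed
    have near: "e \<in> open_by k U t"
      if "e \<in> lattice_edges" "f \<in> lattice_edges" "e \<inter> f \<noteq> {}" "f \<inter> X \<noteq> {}" "e \<notin> H" "e \<notin> P" for e f
      using that unfolding H_def touch_def B_def by blast
    have far: "e \<notin> open_by k U t" if "e \<in> H" "e \<inter> X = {}" for e
      using that unfolding H_def touch_def B_def by blast
    \<comment> \<open>Of the two possible neighbours of \<open>v\<close> one is the other end of
      \<open>e\<close>, so at most one competitor remains.\<close>
    have deg: "card {w. {w, v} \<in> lattice_edges - H - {e}} < k" if e: "e \<in> P" and v: "v \<in> e" for e v
    proof -
      have "v \<in> X" using e v PX by auto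
      then obtain i where i: "i \<le> n" "v = p i" unfolding X_def by auto
      obtain a b where "e = {a, b}" using lattice_edgeE[of e] PL e by blast
      then obtain u where u: "e = {u, v}" using v by (auto simp: insert_commute)
      let ?N = "{if i = 0 then c else p (i - 1), if i = n then c' else p (Suc i)}"
      have uN: "u \<in> ?N" using nb[OF i(1)] e u i by blast
      have "{w. {w, v} \<in> lattice_edges - H - {e}} \<subseteq> ?N - {u}"
      proof
        fix w assume w: "w \<in> {w. {w, v} \<in> lattice_edges - H - {e}}"
        then have "{w, v} \<in> P \<or> {w, v} = {x, c} \<or> {w, v} = {y, c'}"
          using \<open>v \<in> X\<close> unfolding H_def touch_def by auto
        then have "w \<in> ?N" using nb[OF i(1)] i by blast
        then show "w \<in> ?N - {u}" using w u by auto
      qed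
      then have "card {w. {w, v} \<in> lattice_edges - H - {e}} \<le> card (?N - {u})"
        by (intro card_mono) auto
      also have "\<dots> = card ?N - 1" using uN by (intro card_Diff_singleton) 
      also have "\<dots> \<le> 1" by (simp add: card_insert_if)
      finally show ?thesis using k by simp
    qed
    note lm = local_modification[where H = H and P = P and X = X and r = r and t = t and k = k,
      OF wf wfU' PL PX HP same late P1 P2 kept near far deg r(3)]
    show "open_by k U' t = (B - H - P) \<union> P" unfolding B_def by (rule lm(1))
    show "open_by k U' s = S - H - P" unfolding S_def by (rule lm(2)) (use r in auto)
  qed

  define B' where "B' = (B - H - P) \<union> P"
  \<comment> \<open>The targets have to be those of the new clocks. At time \<open>s\<close> edges
    have only been removed, so no target is gained; \<open>y\<close> remains one through
    \<open>c'\<close>.\<close>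
  define I' where "I' = percolating (S - H - P)"
  have I'I: "I' \<subseteq> I" unfolding I'_def I_def by (rule percolating_mono) auto
  \<comment> \<open>The part attached to \<open>x\<close> once the first path edge is cut. That edge
    is its only exit.\<close>
  define K where "K = open_cluster (B' - {{x, p 1}}) x"
  have KC1: "K \<subseteq> C"
    unfolding K_def
  proof (rule open_cluster_subset[OF x(1)])
    fix u w assume u: "u \<in> C" and uw: "{u, w} \<in> B' - {{x, p 1}}"
    show "w \<in> C"
    proof (cases "{u, w} \<in> P")
      case True
      then obtain j where j: "j < n" "{u, w} = {p j, p (Suc j)}" unfolding P_def by auto
      then have "u = p j \<or> u = p (Suc j)" by auto
      then have "u = p j" using pC[of "Suc j"] u j by auto
      then have "j = 0" using pC[of j] u j by (cases j) auto
      \<comment> \<open>Among the path edges only \<open>{x, p 1}\<close> meets \<open>C\<close>,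
        and it has been taken out: a contradiction.\<close>
      then show ?thesis using j uw by (simp add: x_def)
    next
      case False
      then have "{u, w} \<in> B" using uw unfolding B'_def by auto
      then show ?thesis using u open_cluster_step unfolding C_def by blast
    qed
  qed
  have infK: "infinite K"
  proof -
    have "{x, c} \<in> B' - {{x, p 1}}" using c cP cH n unfolding B'_def P_def x_def by auto
    then have cK: "c \<in> K" unfolding K_def by (rule open_cluster_step[OF open_cluster_refl])
    \<comment> \<open>The old branch at \<open>c\<close> survives: its edges avoid \<open>X\<close>,
      so the surgery leaves them alone. Intersecting with the branch keeps this information
      available while the cluster is explored.\<close>
    have "open_cluster {e \<in> B. x \<notin> e} c \<subseteq> open_cluster {e \<in> B. x \<notin> e} c \<inter> K"
    proof (rule open_cluster_subset)
      fix u w assume u: "u \<in> open_cluster {e \<in> B. x \<notin> e} c \<inter> K" and uw: "{u, w} \<in> {e \<in> B. x \<notin> e}"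
      have w: "w \<in> open_cluster {e \<in> B. x \<notin> e} c" by (rule open_cluster_step[of u]) (use u uw in simp_all)
      then have "u \<in> C" "w \<in> C" using u KC by auto
      then have disj: "u \<notin> X" "w \<notin> X" using XC uw by auto
      have "{u, w} \<in> B" using uw by simp
      moreover have "{u, w} \<notin> H" by (rule BH) (use calculation disj in auto)
      moreover have "{u, w} \<notin> P" by (rule PX'[of u]) (use disj in auto)
      ultimately have "{u, w} \<in> B'" unfolding B'_def by simp
      moreover have "{u, w} \<noteq> {x, p 1}" using uw by auto
      ultimately have "{u, w} \<in> B' - {{x, p 1}}" by simp
      then have "w \<in> K" unfolding K_def
        by (rule open_cluster_step[rotated]) (use u in \<open>simp add: K_def\<close>)
      then show "w \<in> open_cluster {e \<in> B. x \<notin> e} c \<inter> K" using w by blast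
    qed (use cK in simp)
    then show ?thesis using infc finite_subset by blast
  qed
  have yI': "y \<in> I'"
  proof -
    let ?Z = "open_cluster (S - H - P) y"
    have "{y, c'} \<in> S - H - P" using c' cP cH by auto
    then have c'Z: "c' \<in> ?Z" by (rule open_cluster_step[OF open_cluster_refl])
    have "open_cluster {e \<in> S. y \<notin> e} c' \<subseteq> open_cluster {e \<in> S. y \<notin> e} c' \<inter> ?Z"
    proof (rule open_cluster_subset)
      fix u w assume u: "u \<in> open_cluster {e \<in> S. y \<notin> e} c' \<inter> ?Z" and uw: "{u, w} \<in> {e \<in> S. y \<notin> e}"
      have w: "w \<in> open_cluster {e \<in> S. y \<notin> e} c'" by (rule open_cluster_step[of u]) (use u uw in simp_all)
      then have "u \<in> I" "w \<in> I" using u DI by auto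
      then have disj: "u \<notin> X" "w \<notin> X" using XI uw by auto
      have "{u, w} \<in> S" "{u, w} \<in> B" using uw SB by auto
      moreover have "{u, w} \<notin> H" by (rule BH) (use calculation disj in auto)
      moreover have "{u, w} \<notin> P" by (rule PX'[of u]) (use disj in auto)
      ultimately have "{u, w} \<in> S - H - P" by simp
      then have "w \<in> ?Z" by (rule open_cluster_step[rotated]) (use u in simp)
      then show "w \<in> open_cluster {e \<in> S. y \<notin> e} c' \<inter> ?Z" using w by blast
    qed (use c'Z in simp)
    then show ?thesis using infc' finite_subset unfolding I'_def percolating_def by blast
  qed
  have pcl: "p i \<in> open_cluster B' x" if "i \<le> n" for i
    using that
  proof (induction i)
    case 0
    then show ?case by (simp add: x_def)
  next
    case (Suc i)
    then have "{p i, p (Suc i)} \<in> B'" unfolding B'_def P_def by auto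
    moreover have "p i \<in> open_cluster B' x" using Suc by simp
    ultimately show ?case by (rule open_cluster_step[rotated])
  qed
  then have "open_cluster B' x \<inter> I' \<noteq> {}" using yI' unfolding y_def by blast
  then obtain z where z: "z \<in> nearest B' I' x" using nearest_nonempty by blast
  have near: "nearest B' I' u = nearest B' I' x" if "u \<in> K" for u
  proof (rule nearest_through_gate[where K = K])
    show "x \<in> K" unfolding K_def by simp
    show "K \<inter> I' = {}" using KC1 I'I CI by blast
    show "u \<in> K" by fact
    have "u \<in> open_cluster B' x"
      using that open_cluster_mono[of "B' - {{x, p 1}}" B' x] unfolding K_def by auto
    then show "x \<in> open_cluster B' u" by (rule open_cluster_sym)
    fix a b assume a: "a \<in> K" "b \<notin> K" "{a, b} \<in> B'"
    have "{a, b} \<notin> B' - {{x, p 1}}"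
    proof
      assume "{a, b} \<in> B' - {{x, p 1}}"
      with a(1) have "b \<in> K" unfolding K_def by (rule open_cluster_step)
      with a(2) show False ..
    qed
    then have "{a, b} = {x, p 1}" using a(3) by simp
    moreover have "b \<noteq> x" using a unfolding K_def by auto
    ultimately show "a = x" by (auto simp: doubleton_eq_iff)
  qed
  have eqs: "open_by k (resample H P r t U) t = B'"
    "percolating (open_by k (resample H P r t U) s) = I'"
    using mod mod' unfolding B'_def I'_def U'_def by simp_all
  show thesis
    by (rule that[OF finH finP _ r(1) _ r(3) infK, of z x]) (use HL PL r z near in \<open>auto simp: eqs\<close>)
qed

section \<open>The clock measure\<close>

definition unit_uniform :: "real measure" where
  "unit_uniform = restrict_space lborel {0..1}"

lemma space_unit_uniform [simp]: "space unit_uniform = {0..1}"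
  unfolding unit_uniform_def by (simp add: space_restrict_space)

lemma prob_space_unit_uniform: "prob_space unit_uniform"
  by (rule prob_spaceI) (simp add: unit_uniform_def emeasure_restrict_space space_restrict_space)

lemma clock_measure_eq: "clock_measure = (\<Pi>\<^sub>M e\<in>lattice_edges. unit_uniform)"
  unfolding clock_measure_def unit_uniform_def ..

interpretation clocks: product_prob_space "\<lambda>e. unit_uniform" "lattice_edges :: (int ^ 'd) set set"
proof -
  interpret prob_space unit_uniform by (rule prob_space_unit_uniform)
  show "product_prob_space (\<lambda>e. unit_uniform)" by unfold_locales
qed

interpretation clock: prob_space "clock_measure :: ((int ^ 'd) set \<Rightarrow> real) measure"
  unfolding clock_measure_eq by (rule prob_space_PiM) (rule prob_space_unit_uniform)

lemma space_clock_measure: "space clock_measure = lattice_edges \<rightarrow>\<^sub>E {0..1}"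
  unfolding clock_measure_eq by (simp add: space_PiM)

lemma measurable_unit_uniform: "f \<in> borel_measurable M \<Longrightarrow> (\<And>x. x \<in> space M \<Longrightarrow> f x \<in> {0..1}) \<Longrightarrow>
    f \<in> measurable M unit_uniform"
  unfolding unit_uniform_def by (rule measurable_restrict_space2) auto

lemma measurable_from_unit_uniform: "f \<in> measurable M unit_uniform \<Longrightarrow> f \<in> borel_measurable M"
  unfolding unit_uniform_def by (simp add: measurable_restrict_space2_iff)

text \<open>Off the lattice edges the points of the product space take the constant value
  \<open>undefined\<close>, so measurability holds for every \<open>e\<close>.\<close>

lemma measurable_clock [measurable]: "(\<lambda>U. U e) \<in> borel_measurable clock_measure"
proof (cases "e \<in> lattice_edges")
  case True
  then show ?thesis
    unfolding clock_measure_eq by (intro measurable_from_unit_uniform measurable_component_singleton)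
next
  case False
  have "(\<lambda>U. U e) \<in> borel_measurable clock_measure \<longleftrightarrow>
      (\<lambda>U. undefined :: real) \<in> borel_measurable (clock_measure :: ((int ^ 'a) set \<Rightarrow> real) measure)"
    by (rule measurable_cong) (use False in \<open>auto simp: space_clock_measure PiE_def extensional_def\<close>)
  then show ?thesis by simp
qed

lemma AE_clock:
  "AE U in clock_measure. \<forall>e\<in>lattice_edges. 0 < U e \<and> U e \<le> 1 \<and> U e \<noteq> t"
proof -
  have "AE x in lborel. x \<noteq> 0 \<and> x \<noteq> (t :: real)"
    using AE_lborel_singleton[of 0] AE_lborel_singleton[of t] by eventually_elim simp
  then have "AE x in unit_uniform. 0 < x \<and> x \<le> 1 \<and> x \<noteq> t"
    unfolding unit_uniform_def by (subst AE_restrict_space_iff) auto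
  then have "AE U in clock_measure. 0 < U e \<and> U e \<le> 1 \<and> U e \<noteq> t" if "e \<in> lattice_edges" for e
    unfolding clock_measure_eq using that by (intro AE_PiM_component prob_space_unit_uniform)
  then show ?thesis unfolding AE_ball_countable[OF countable_lattice_edges] by (rule ballI)
qed

section \<open>Almost sure well-foundedness of the clocks\<close>

text \<open>The starting edge is not listed, so a chain of length \<open>n\<close> involves exactly
  \<open>n\<close> clocks to be estimated.\<close>

primrec adjacent_chains :: "nat \<Rightarrow> (int ^ 'd) set \<Rightarrow> (int ^ 'd) set list set" where
  "adjacent_chains 0 e = {[]}"
| "adjacent_chains (Suc n) e = (\<Union>f\<in>adjacent_edges e. (#) f ` adjacent_chains n f)"

lemma adjacent_chains:
  fixes e :: "(int ^ 'd) set"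
  assumes "e \<in> lattice_edges"
  shows "finite (adjacent_chains n e) \<and>
    card (adjacent_chains n e) \<le> (2 * card {x. {x, 0 :: int ^ 'd} \<in> lattice_edges}) ^ n \<and>
    (\<forall>c\<in>adjacent_chains n e. length c = n \<and> set c \<subseteq> lattice_edges)"
  using assms
proof (induction n arbitrary: e)
  case (Suc n)
  let ?D = "2 * card {x. {x, 0 :: int ^ 'd} \<in> lattice_edges}"
  have adj: "finite (adjacent_edges e)" "card (adjacent_edges e) \<le> ?D" "adjacent_edges e \<subseteq> lattice_edges"
    using adjacent_edges_le[OF Suc.prems] unfolding adjacent_edges_def by auto
  have "card (adjacent_chains (Suc n) e) \<le> (\<Sum>f\<in>adjacent_edges e. card ((#) f ` adjacent_chains n f))"
    using card_UN_le[OF adj(1)] by simp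
  also have "\<dots> \<le> (\<Sum>f\<in>adjacent_edges e. ?D ^ n)"
    using Suc.IH adj by (intro sum_mono) (auto simp: card_image)
  also have "\<dots> \<le> ?D * ?D ^ n" using adj(2) by simp
  finally have "card (adjacent_chains (Suc n) e) \<le> ?D ^ Suc n" by simp
  moreover have "finite (adjacent_chains (Suc n) e)"
    using Suc.IH adj by auto
  moreover have "\<forall>c\<in>adjacent_chains (Suc n) e. length c = Suc n \<and> set c \<subseteq> lattice_edges"
    using Suc.IH adj by fastforce
  ultimately show ?case by blast
qed auto

text \<open>By independence. Only an inequality, because the interval may stick out of
  \<open>[0, 1]\<close>.\<close>

lemma emeasure_clocks_in_interval:
  assumes "finite J" "J \<subseteq> lattice_edges" "b \<ge> 0"
  shows "emeasure clock_measure {U \<in> space clock_measure. \<forall>e\<in>J. U e \<in> {a..a + b}} \<le> ennreal b ^ card J"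
proof -
  let ?A = "{a..a + b} \<inter> {0..1} :: real set"
  have A: "?A \<in> sets unit_uniform" unfolding unit_uniform_def by (auto simp: sets_restrict_space)
  have "{U \<in> space clock_measure. \<forall>e\<in>J. U e \<in> {a..a + b}} =
      {U \<in> space clock_measure. \<forall>e\<in>J. U e \<in> ?A}"
    using assms by (auto simp: space_clock_measure)
  moreover have "emeasure clock_measure {U \<in> space clock_measure. \<forall>e\<in>J. U e \<in> ?A} =
      (\<Prod>e\<in>J. emeasure unit_uniform ?A)"
    unfolding clock_measure_eq using assms A by (intro clocks.emeasure_PiM_Collect)
  ultimately have "emeasure clock_measure {U \<in> space clock_measure. \<forall>e\<in>J. U e \<in> {a..a + b}} =
      (\<Prod>e\<in>J. emeasure unit_uniform ?A)"
    by (simp only:)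
  also have "\<dots> = emeasure unit_uniform ?A ^ card J" by simp
  also have "emeasure unit_uniform ?A \<le> emeasure lborel {a..a + b}"
    unfolding unit_uniform_def by (subst emeasure_restrict_space) (auto intro!: emeasure_mono)
  then have "emeasure unit_uniform ?A ^ card J \<le> ennreal b ^ card J"
    using assms by (intro power_mono) auto
  finally show ?thesis .
qed

text \<open>An infinite chain of decreasing clocks eventually stays in a single time slot, but the edges
  ringing within a slot of length \<open>b < 1 / D\<close> form a subcritical percolation.\<close>

lemma AE_no_long_chain:
  fixes e :: "(int ^ 'd) set"
  assumes e: "e \<in> lattice_edges" and b: "b \<ge> 0"
    "b * (2 * real (card {x. {x, 0 :: int ^ 'd} \<in> lattice_edges})) < 1"
  shows "AE U in clock_measure. \<not> (\<forall>n. \<exists>c\<in>adjacent_chains n e. distinct c \<and> (\<forall>f\<in>set c. U f \<in> {a..a + b}))"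
proof -
  let ?D = "2 * card {x. {x, 0 :: int ^ 'd} \<in> lattice_edges}"
  let ?Z = "\<lambda>c. {U \<in> space clock_measure. \<forall>f\<in>set c. U f \<in> {a..a + b}}"
  let ?C = "\<lambda>n. {c \<in> adjacent_chains n e. distinct c}"
  let ?E = "\<Inter>n. \<Union>c\<in>?C n. ?Z c"
  have Z: "?Z c \<in> sets clock_measure" for c by measurable
  have fin: "finite (?C n)" for n using adjacent_chains[OF e] by auto
  have E: "?E \<in> sets clock_measure"
    using Z fin by (intro sets.countable_INT' sets.finite_UN) auto
  have gen: "real (m ^ n) * b ^ n = (b * real m) ^ n" for m n
    by (simp add: power_mult_distrib mult.commute)
  \<comment> \<open>Union bound over at most \<open>?D ^ n\<close> chains. Distinctness gives each
    chain \<open>n\<close> independent clocks and hence probability at most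
    \<open>b ^ n\<close>.\<close>
  have bound: "emeasure clock_measure ?E \<le> ennreal ((b * real ?D) ^ n)" for n
  proof -
    have "emeasure clock_measure ?E \<le> emeasure clock_measure (\<Union>c\<in>?C n. ?Z c)"
      using Z fin by (intro emeasure_mono sets.finite_UN) auto
    also have "\<dots> \<le> (\<Sum>c\<in>?C n. emeasure clock_measure (?Z c))"
      using Z fin by (intro emeasure_subadditive_finite) auto
    also have "\<dots> \<le> (\<Sum>c\<in>?C n. ennreal b ^ n)"
    proof (rule sum_mono)
      fix c assume c: "c \<in> ?C n"
      then have "card (set c) = n" "set c \<subseteq> lattice_edges"
        using adjacent_chains[OF e, of n] by (auto simp: distinct_card)
      then show "emeasure clock_measure (?Z c) \<le> ennreal b ^ n"
        using emeasure_clocks_in_interval[of "set c" b a] b by simp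
    qed
    also have "\<dots> = of_nat (card (?C n)) * ennreal b ^ n" by simp
    also have "\<dots> \<le> of_nat (?D ^ n) * ennreal b ^ n"
    proof (intro mult_right_mono)
      have "card (?C n) \<le> card (adjacent_chains n e)"
        using adjacent_chains[OF e] by (intro card_mono) auto
      then have "card (?C n) \<le> ?D ^ n" using adjacent_chains[OF e, of n] by linarith
      then show "of_nat (card (?C n)) \<le> (of_nat (?D ^ n) :: ennreal)" by (rule of_nat_mono)
    qed simp
    also have "\<dots> = ennreal (real (?D ^ n)) * ennreal (b ^ n)"
      using b(1) by (simp only: ennreal_power ennreal_of_nat_eq_real_of_nat)
    also have "\<dots> = ennreal (real (?D ^ n) * b ^ n)"
      using b(1) by (intro ennreal_mult[symmetric]) simp_all
    also have "real (?D ^ n) * b ^ n = (b * real ?D) ^ n"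
      by (rule gen)
    finally show ?thesis .
  qed
  have "(\<lambda>n. ennreal ((b * real ?D) ^ n)) \<longlonglongrightarrow> ennreal 0"
    using b by (intro tendsto_ennrealI LIMSEQ_power_zero) auto
  then have "emeasure clock_measure ?E \<le> ennreal 0"
    by (rule LIMSEQ_le_const) (use bound in auto)
  then have "?E \<in> null_sets clock_measure" using E by auto
  then have "AE U in clock_measure. U \<notin> ?E" by (rule AE_not_in)
  then show ?thesis
  proof (rule AE_mp, intro AE_I2 impI notI)
    fix U assume U: "U \<in> space clock_measure" "U \<notin> ?E"
      and *: "\<forall>n. \<exists>c\<in>adjacent_chains n e. distinct c \<and> (\<forall>f\<in>set c. U f \<in> {a..a + b})"
    define F where "F n = (\<Union>c\<in>?C n. ?Z c)" for n
    have "\<exists>n. U \<notin> F n" using U(2) unfolding F_def[symmetric] by simp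
    then obtain n where n: "U \<notin> (\<Union>c\<in>?C n. ?Z c)" unfolding F_def ..
    from spec[OF *, of n] obtain c where c: "c \<in> ?C n" "\<forall>f\<in>set c. U f \<in> {a..a + b}" by blast
    have "U \<in> ?Z c" using U(1) c(2) by simp
    then have "U \<in> (\<Union>c\<in>?C n. ?Z c)" by (rule UN_I[OF c(1)])
    then show False by (rule notE[OF n])
  qed
qed

lemma AE_wf_earlier: "AE U in clock_measure. wf (earlier (U :: (int ^ 'd) set \<Rightarrow> real))"
proof -
  define D where "D = 2 * card {x. {x, 0 :: int ^ 'd} \<in> lattice_edges}"
  \<comment> \<open>The successor makes \<open>b * D\<close> strictly less than 1, as the count of
    chains requires.\<close>
  define b where "b = 1 / real (Suc D)"
  have b: "b > 0" "b * real D < 1" unfolding b_def by auto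
  have "AE U in clock_measure. \<forall>e\<in>lattice_edges :: (int ^ 'd) set set. \<forall>j::nat.
      \<not> (\<forall>n. \<exists>c\<in>adjacent_chains n e. distinct c \<and> (\<forall>f\<in>set c. U f \<in> {b * j..b * j + b}))"
    unfolding AE_ball_countable[OF countable_lattice_edges] AE_all_countable
    using b by (intro ballI allI AE_no_long_chain) (auto simp: D_def)
  then show ?thesis using AE_clock[of 0]
  proof eventually_elim
    case (elim U)
    show ?case
      unfolding wf_iff_no_infinite_down_chain
    proof
      assume "\<exists>f. \<forall>i. (f (Suc i), f i) \<in> earlier U"
      then obtain f where f: "\<And>i. (f (Suc i), f i) \<in> earlier U" by blast
      have fL: "f i \<in> lattice_edges" and adj: "f (Suc i) \<in> adjacent_edges (f i)"
        and less: "U (f (Suc i)) < U (f i)" for i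
        using f[of i] unfolding earlier_def by auto
      have dec: "U (f j) < U (f i)" if "i < j" for i j
        using less lift_Suc_mono_less[of "\<lambda>i. - U (f i)" i j] that by simp
      define slot where "slot i = nat \<lfloor>U (f i) / b\<rfloor>" for i
      define m where "m = (LEAST m. \<exists>i. slot i = m)"
      obtain N where N: "slot N = m" unfolding m_def by (rule exE[OF LeastI_ex[of "\<lambda>m. \<exists>i. slot i = m"]]) auto
      \<comment> \<open>Slot numbers do not increase along the chain, so they are constant from an
        index where the least one is attained.\<close>
      have slot: "slot i = m" if "i \<ge> N" for i
      proof (rule antisym)
        have "U (f i) \<le> U (f N)" using dec[of N i] that by (cases "i = N") auto
        then have "slot i \<le> slot N"
          unfolding slot_def using b by (intro nat_mono floor_mono divide_right_mono) auto
        then show "slot i \<le> m" using N by simp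
        show "m \<le> slot i" unfolding m_def by (rule Least_le) auto
      qed
      have in_slot: "U (f i) \<in> {b * m..b * m + b}" if "i \<ge> N" for i
      proof -
        have "U (f i) > 0" using elim(2) fL by blast
        then have "0 \<le> U (f i) / b" using b by simp
        then have "\<lfloor>U (f i) / b\<rfloor> = int m" using slot[OF that] unfolding slot_def by auto
        then have "real m \<le> U (f i) / b" "U (f i) / b < real m + 1"
          by (simp_all add: floor_eq_iff)
        then show ?thesis using b by (auto simp: field_simps)
      qed
      have chain: "map f [Suc i..<Suc i + n] \<in> adjacent_chains n (f i)" for n i
      proof (induction n arbitrary: i)
        case (Suc n)
        have "map f [Suc i..<Suc i + Suc n] = f (Suc i) # map f [Suc (Suc i)..<Suc (Suc i) + n]"
          by (simp add: upt_rec)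
        then show ?case
          unfolding adjacent_chains.simps using adj[of i] Suc.IH[of "Suc i"]
          by (simp only:) (rule UN_I, assumption, rule imageI)
      qed simp
      have inj_f: "inj f" by (rule injI) (metis dec less_irrefl linorder_neqE_nat)
      have "distinct (map f [Suc N..<Suc N + n])" for n
        unfolding distinct_map using inj_on_subset[OF inj_f] distinct_upt by blast
      then have "\<exists>c\<in>adjacent_chains n (f N). distinct c \<and> (\<forall>e\<in>set c. U e \<in> {b * m..b * m + b})" for n
        using chain[of N n] in_slot by (intro bexI[of _ "map f [Suc N..<Suc N + n]"]) auto
      then show False using elim(1) fL[of N] by blast
    qed
  qed
qed

section \<open>Measurability of the events and the percolation function\<close>

text \<open>Finite subsets are represented by lists. There are countably many, so the bound on the
  cardinality becomes a countable combination of membership events.\<close>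

lemma pred_card_less:
  fixes S :: "'a \<Rightarrow> 'b :: countable set"
  assumes [measurable]: "\<And>x. Measurable.pred M (\<lambda>U. x \<in> S U)" and fin: "\<And>U. finite (S U)"
  shows "Measurable.pred M (\<lambda>U. card (S U) < k)"
proof -
  have "card (S U) < k \<longleftrightarrow> \<not> (\<exists>xs::'b list. (distinct xs \<and> length xs = k) \<and> (\<forall>x\<in>set xs. x \<in> S U))" for U
  proof -
    have "(\<exists>xs::'b list. (distinct xs \<and> length xs = k) \<and> (\<forall>x\<in>set xs. x \<in> S U)) \<longleftrightarrow> k \<le> card (S U)"
    proof
      assume "k \<le> card (S U)"
      then obtain T where T: "T \<subseteq> S U" "card T = k" "finite T"
        using obtain_subset_with_card_n by metis
      then obtain xs where "set xs = T" "distinct xs" using finite_distinct_list by blast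
      then show "\<exists>xs::'b list. (distinct xs \<and> length xs = k) \<and> (\<forall>x\<in>set xs. x \<in> S U)"
        using T by (auto simp: distinct_card intro!: exI[of _ xs])
    next
      assume "\<exists>xs::'b list. (distinct xs \<and> length xs = k) \<and> (\<forall>x\<in>set xs. x \<in> S U)"
      then obtain xs where xs: "distinct xs" "length xs = k" "set xs \<subseteq> S U" by blast
      then show "k \<le> card (S U)" using card_mono[OF fin xs(3)] by (simp add: distinct_card)
    qed
    then show ?thesis by auto
  qed
  then show ?thesis by simp
qed

lemma pred_infinite:
  fixes S :: "'a \<Rightarrow> 'b :: countable set"
  assumes [measurable]: "\<And>x. Measurable.pred M (\<lambda>U. x \<in> S U)"
  shows "Measurable.pred M (\<lambda>U. infinite (S U))"
proof -
  have "infinite (S U) \<longleftrightarrow> (\<forall>xs::'b list. \<exists>x. x \<notin> set xs \<and> x \<in> S U)" for U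
    by (metis List.finite_set finite_list finite_subset subsetI)
  then show ?thesis by simp
qed

lemma pred_opened_approx: "Measurable.pred clock_measure (\<lambda>U. e \<in> opened_approx k U n)"
proof (induction n arbitrary: e)
  case (Suc n)
  show ?case
  proof (cases "e \<in> lattice_edges")
    case True
    then have "finite e" using lattice_edgeE by blast
    have [measurable]: "Measurable.pred clock_measure (\<lambda>U. card {x. {x, v} \<in> opened_approx k U n \<and> U {x, v} < U e} < k)" for v
    proof (rule pred_card_less)
      note Suc[measurable]
      show "Measurable.pred clock_measure (\<lambda>U. x \<in> {x. {x, v} \<in> opened_approx k U n \<and> U {x, v} < U e})" for x
        unfolding mem_Collect_eq by measurable
      show "finite {x. {x, v} \<in> opened_approx k U n \<and> U {x, v} < U e}" for U
        by (rule finite_subset[OF _ finite_neighbours[of v]]) (use opened_approx_lattice in auto)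
    qed
    show ?thesis using True \<open>finite e\<close> unfolding opened_approx.simps admissible_def by simp
  qed simp
qed simp

lemma pred_open_by [measurable]: "Measurable.pred clock_measure (\<lambda>U. e \<in> open_by k U t)"
proof -
  note pred_opened_approx[measurable]
  show ?thesis unfolding open_by_def opened_def mem_Collect_eq by measurable
qed

lemma pred_reach:
  assumes [measurable]: "\<And>e. Measurable.pred M (\<lambda>U. e \<in> B U)"
  shows "Measurable.pred M (\<lambda>U. w \<in> reach (B U) n v)"
proof (induction n arbitrary: w)
  case (Suc n)
  note Suc[measurable]
  have "w \<in> reach (B U) (Suc n) v \<longleftrightarrow> w \<in> reach (B U) n v \<or> (\<exists>u. u \<in> reach (B U) n v \<and> {u, w} \<in> B U)" for U
    by auto
  then show ?case by simp
qed simp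

lemma pred_percolating:
  assumes [measurable]: "\<And>e. Measurable.pred M (\<lambda>U. e \<in> B U)"
  shows "Measurable.pred M (\<lambda>U. v \<in> percolating (B U))"
  unfolding percolating_def mem_Collect_eq
proof (rule pred_infinite)
  note pred_reach[measurable]
  show "Measurable.pred M (\<lambda>U. w \<in> open_cluster (B U) v)" for w
    unfolding open_cluster_reach by simp
qed

lemma pred_nearest:
  assumes [measurable]: "\<And>e. Measurable.pred M (\<lambda>U. e \<in> B U)" "\<And>v. Measurable.pred M (\<lambda>U. v \<in> I U)"
  shows "Measurable.pred M (\<lambda>U. z \<in> nearest (B U) (I U) v)"
proof -
  note pred_reach[measurable]
  have "z \<in> nearest (B U) (I U) v \<longleftrightarrow> z \<in> I U \<and> (\<exists>n. z \<in> reach (B U) n v \<and>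
      (\<forall>j. j < n \<longrightarrow> (\<forall>w. \<not> (w \<in> reach (B U) j v \<and> w \<in> I U))))" for U
    unfolding nearest_def by blast
  then show ?thesis by simp
qed

text \<open>\<open>open_edges\<close> is uncontrolled on a null set, so its event is handled in the
  completion. It differs from the measurable event of \<open>open_by\<close> only inside that null
  set.\<close>

lemma percolation_function_eq:
  assumes "k \<ge> 1"
  shows "percolation_function TYPE('d::finite) k t =
    measure clock_measure {U \<in> space clock_measure. (0 :: int ^ 'd) \<in> percolating (open_by k U t)}"
proof -
  let ?M = "clock_measure :: ((int ^ 'd) set \<Rightarrow> real) measure"
  let ?S = "{U \<in> space ?M. infinite (open_cluster (open_edges k U t) 0)}"
  let ?S' = "{U \<in> space ?M. 0 \<in> percolating (open_by k U t)}"
  note pred_percolating[measurable]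
  have S': "?S' \<in> sets ?M" by measurable
  have "AE U in ?M. open_edges k U = open_by k U"
    using AE_wf_earlier AE_clock[of 0] by eventually_elim (rule open_edges_eq, use assms in auto)
  then obtain N where N: "N \<in> null_sets ?M" "\<And>U. U \<in> space ?M \<Longrightarrow> U \<notin> N \<Longrightarrow> open_edges k U = open_by k U"
    by (auto elim!: AE_E3)
  have eq: "?S = (?S' - N) \<union> (?S \<inter> N)"
    using N(2) unfolding percolating_def by auto
  have 1: "?S \<inter> N \<in> null_sets (completion ?M)"
    by (rule null_sets_completion_subset[OF Int_lower2 null_sets_completionI[OF N(1)]])
  have 2: "?S' - N \<in> sets ?M" using S' N by auto
  have "measure (completion ?M) ?S = measure (completion ?M) (?S' - N)"
    by (subst eq, rule measure_Un_null_set) (use 1 2 in auto)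
  also have "\<dots> = measure ?M (?S' - N)" using 2 by simp
  also have "\<dots> = measure ?M ?S'" by (rule measure_Diff_null_set[OF S' N(1)])
  finally show ?thesis unfolding percolation_function_def .
qed

section \<open>Translation invariance and ergodicity\<close>

abbreviation translate :: "int ^ 'd \<Rightarrow> (int ^ 'd) set \<Rightarrow> (int ^ 'd) set" where
  "translate z e \<equiv> (\<lambda>v. v + z) ` e"

text \<open>The restriction keeps shifted clocks inside the product space, whose points are
  \<open>undefined\<close> off the lattice edges.\<close>

definition shift_clocks :: "int ^ 'd \<Rightarrow> ((int ^ 'd) set \<Rightarrow> real) \<Rightarrow> (int ^ 'd) set \<Rightarrow> real" where
  "shift_clocks z U = (\<lambda>e\<in>lattice_edges. U (translate z e))"

lemma image_translate_Collect: "(\<lambda>x. x + z) ` {x. P (x + z)} = {x :: 'a :: group_add. P x}"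
proof (intro equalityI subsetI)
  fix x assume "x \<in> {x. P x}"
  then show "x \<in> (\<lambda>x. x + z) ` {x. P (x + z)}" by (intro image_eqI[of _ _ "x - z"]) simp_all
qed auto

lemma inj_translate: "inj (translate z)"
  by (rule injI) (simp add: inj_image_eq_iff)

lemma distr_shift: "distr clock_measure clock_measure (shift_clocks z) = clock_measure"
proof -
  have "distr (Pi\<^sub>M lattice_edges (\<lambda>_. unit_uniform)) (\<Pi>\<^sub>M e\<in>lattice_edges. unit_uniform)
      (\<lambda>U. \<lambda>e\<in>lattice_edges. U (translate z e)) = (\<Pi>\<^sub>M e\<in>lattice_edges. unit_uniform)"
    by (rule distr_PiM_reindex[where M = "\<lambda>_. unit_uniform"])
      (auto simp: prob_space_unit_uniform translate_edge intro: inj_on_subset[OF inj_translate])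
  then show ?thesis unfolding clock_measure_eq shift_clocks_def .
qed

lemma measurable_shift [measurable]: "shift_clocks z \<in> measurable clock_measure clock_measure"
  unfolding clock_measure_eq shift_clocks_def
  by (intro measurable_restrict measurable_component_singleton) (simp add: translate_edge)

lemma AE_shift: "AE U in clock_measure. Q U \<Longrightarrow> AE U in clock_measure. Q (shift_clocks z U)"
  using AE_distrD[OF measurable_shift, of Q z] unfolding distr_shift .

lemma emeasure_shift:
  assumes "A \<in> sets clock_measure"
  shows "emeasure clock_measure (shift_clocks z -` A \<inter> space clock_measure) = emeasure clock_measure A"
  using emeasure_distr[OF measurable_shift assms, of z] unfolding distr_shift by simp

lemma admissible_shift:
  assumes S: "S \<subseteq> lattice_edges" and e: "e \<in> lattice_edges"
  shows "admissible k (shift_clocks z U) {f. translate z f \<in> S} e \<longleftrightarrow> admissible k U S (translate z e)"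
proof -
  have "card {x. translate z {x, v} \<in> S \<and> shift_clocks z U {x, v} < shift_clocks z U e} =
      card {x. {x, v + z} \<in> S \<and> U {x, v + z} < U (translate z e)}" for v
  proof (rule bij_betw_same_card[of "\<lambda>x. x + z"])
    have "translate z {x, v} \<in> S \<and> shift_clocks z U {x, v} < shift_clocks z U e \<longleftrightarrow>
        {x + z, v + z} \<in> S \<and> U {x + z, v + z} < U (translate z e)" for x
    proof (cases "{x + z, v + z} \<in> S")
      case True
      then have "{x, v} \<in> lattice_edges" using S translate_edge[of z "{x, v}"] by auto
      then show ?thesis using True e by (simp add: shift_clocks_def)
    qed simp
    then have "(\<lambda>x. x + z) ` {x. translate z {x, v} \<in> S \<and> shift_clocks z U {x, v} < shift_clocks z U e} =
        {x. {x, v + z} \<in> S \<and> U {x, v + z} < U (translate z e)}"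
      by (simp add: image_translate_Collect[of z "\<lambda>x. {x, v + z} \<in> S \<and> U {x, v + z} < U (translate z e)"])
    then show "bij_betw (\<lambda>x. x + z) {x. translate z {x, v} \<in> S \<and> shift_clocks z U {x, v} < shift_clocks z U e}
        {x. {x, v + z} \<in> S \<and> U {x, v + z} < U (translate z e)}"
      by (simp add: bij_betw_def inj_on_def)
  qed
  then show ?thesis unfolding admissible_def by simp
qed

lemma opened_approx_shift:
  "opened_approx k (shift_clocks z U) n = {e. translate z e \<in> opened_approx k U n}"
proof (induction n)
  case (Suc n)
  show ?case
    by (simp add: Suc translate_edge admissible_shift[OF opened_approx_lattice] cong: conj_cong)
qed simp

text \<open>Equivariance holds for every clock configuration, ill-founded ones included, because
  each finite approximation has it. The zero-one law can thus be stated for exactly invariant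
  events.\<close>

lemma open_by_shift: "open_by k (shift_clocks z U) t = {e. translate z e \<in> open_by k U t}"
proof -
  have "opened k (shift_clocks z U) = {e. translate z e \<in> opened k U}"
    unfolding opened_def opened_approx_shift by simp
  moreover have "shift_clocks z U e = U (translate z e)" if "translate z e \<in> opened k U" for e
    using that opened_lattice[of k U] translate_edge[of z e] by (auto simp: shift_clocks_def)
  ultimately show ?thesis unfolding open_by_def by auto
qed

lemma reach_shift: "w \<in> reach {e. translate z e \<in> B} n v \<longleftrightarrow> w + z \<in> reach B n (v + z)"
proof (induction n arbitrary: w)
  case (Suc n)
  have "(\<exists>u\<in>reach {e. translate z e \<in> B} n v. {u + z, w + z} \<in> B) \<longleftrightarrow>
      (\<exists>u\<in>reach B n (v + z). {u, w + z} \<in> B)"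
  proof
    assume "\<exists>u\<in>reach B n (v + z). {u, w + z} \<in> B"
    then obtain u where "u \<in> reach B n (v + z)" "{u, w + z} \<in> B" by blast
    then have "u - z \<in> reach {e. translate z e \<in> B} n v" "{(u - z) + z, w + z} \<in> B"
      using Suc[of "u - z"] by simp_all
    then show "\<exists>u\<in>reach {e. translate z e \<in> B} n v. {u + z, w + z} \<in> B" by blast
  qed (use Suc in auto)
  then show ?case using Suc by simp
qed simp

lemma percolating_shift: "v \<in> percolating {e. translate z e \<in> B} \<longleftrightarrow> v + z \<in> percolating B"
proof -
  have "open_cluster B (v + z) = (\<lambda>w. w + z) ` open_cluster {e. translate z e \<in> B} v"
  proof (intro equalityI subsetI)
    fix w assume "w \<in> open_cluster B (v + z)"
    then have "w - z \<in> open_cluster {e. translate z e \<in> B} v"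
      unfolding open_cluster_reach by (simp add: reach_shift)
    then show "w \<in> (\<lambda>w. w + z) ` open_cluster {e. translate z e \<in> B} v"
      by (rule image_eqI[rotated]) simp
  qed (auto simp: open_cluster_reach reach_shift)
  then show ?thesis unfolding percolating_def by (simp add: finite_image_iff inj_on_def)
qed

lemma nearest_shift:
  "w \<in> nearest {e. translate z e \<in> B} {v. v + z \<in> I} v \<longleftrightarrow> w + z \<in> nearest B I (v + z)"
proof -
  have "reach {e. translate z e \<in> B} j v \<inter> {v. v + z \<in> I} = {} \<longleftrightarrow> reach B j (v + z) \<inter> I = {}" for j
  proof -
    have "reach B j (v + z) \<inter> I = (\<lambda>w. w + z) ` (reach {e. translate z e \<in> B} j v \<inter> {v. v + z \<in> I})"
      using image_translate_Collect[of z "\<lambda>w. w \<in> reach B j (v + z) \<inter> I"]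
      by (simp add: reach_shift Int_def)
    then show ?thesis by simp
  qed
  then show ?thesis unfolding nearest_def by (simp add: reach_shift)
qed

lemma infinite_UNIV_vertices: "infinite (UNIV :: (int ^ 'd) set)"
proof
  assume "finite (UNIV :: (int ^ 'd) set)"
  then have "finite ((\<lambda>v. v $ undefined) ` (UNIV :: (int ^ 'd) set))" by (rule finite_imageI)
  moreover have "n \<in> (\<lambda>v. v $ undefined) ` (UNIV :: (int ^ 'd) set)" for n :: int
    by (rule image_eqI[of _ _ "\<chi> i. n"]) simp_all
  then have "(\<lambda>v. v $ undefined) ` (UNIV :: (int ^ 'd) set) = UNIV" by blast
  ultimately show False by (simp add: infinite_UNIV_int)
qed

section \<open>The zero-one law for translation invariant events\<close>

text \<open>Dependence on the clocks in \<open>J\<close> is expressed as insensitivity to all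
  others. In this form it passes directly to complements, unions and shifts.\<close>

definition cylinder :: "((int ^ 'd) set \<Rightarrow> real) set \<Rightarrow> (int ^ 'd) set set \<Rightarrow> bool" where
  "cylinder B J \<longleftrightarrow> finite J \<and> J \<subseteq> lattice_edges \<and> B \<in> sets clock_measure \<and>
     (\<forall>U\<in>space clock_measure. \<forall>V\<in>space clock_measure.
        (\<forall>e\<in>J. U e = V e) \<longrightarrow> (U \<in> B \<longleftrightarrow> V \<in> B))"

lemma cylinder_Compl: "cylinder B J \<Longrightarrow> cylinder (space clock_measure - B) J"
  unfolding cylinder_def by blast

lemma cylinder_Un: "cylinder B J \<Longrightarrow> cylinder B' J' \<Longrightarrow> cylinder (B \<union> B') (J \<union> J')"
  unfolding cylinder_def by (intro conjI ballI impI sets.Un) (blast+)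

lemma cylinder_shift:
  assumes "cylinder B J"
  shows "cylinder (shift_clocks z -` B \<inter> space clock_measure) (translate z ` J)"
  unfolding cylinder_def
proof (intro conjI ballI impI)
  show "finite (translate z ` J)" "translate z ` J \<subseteq> lattice_edges"
    using assms translate_edge unfolding cylinder_def by auto
  have B: "B \<in> sets clock_measure" using assms unfolding cylinder_def by blast
  then show "shift_clocks z -` B \<inter> space clock_measure \<in> sets clock_measure" by measurable
  fix U V assume UV: "U \<in> space clock_measure" "V \<in> space clock_measure" "\<forall>e\<in>translate z ` J. U e = V e"
  then have "shift_clocks z U \<in> space clock_measure" "shift_clocks z V \<in> space clock_measure"
    by (auto intro: measurable_space[OF measurable_shift])
  moreover have "\<forall>e\<in>J. shift_clocks z U e = shift_clocks z V e"
    using UV(3) assms unfolding cylinder_def by (auto simp: shift_clocks_def)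
  ultimately have "shift_clocks z U \<in> B \<longleftrightarrow> shift_clocks z V \<in> B"
    using assms unfolding cylinder_def by blast
  then show "U \<in> shift_clocks z -` B \<inter> space clock_measure \<longleftrightarrow> V \<in> shift_clocks z -` B \<inter> space clock_measure"
    using UV(1,2) by simp
qed

lemma lattice_edges_nonempty: "lattice_edges \<noteq> ({} :: (int ^ 'd) set set)"
proof -
  have "(\<Sum>i\<in>UNIV. \<bar>(axis j 1 :: int ^ 'd) $ i - 0 $ i\<bar>) = (\<Sum>i\<in>UNIV. if i = j then 1 else 0)" for j
    by (rule sum.cong) (auto simp: axis_def)
  then have "{axis j 1, 0 :: int ^ 'd} \<in> lattice_edges" for j
    unfolding lattice_edge_iff by simp
  then show ?thesis by blast
qed

lemma indep_vars_clocks: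
  "clock.indep_vars (\<lambda>_. unit_uniform) (\<lambda>e U. U e) (lattice_edges :: (int ^ 'd) set set)"
proof (rule iffD2[OF clock.indep_vars_iff_distr_eq_PiM'])
  let ?M = "clock_measure :: ((int ^ 'd) set \<Rightarrow> real) measure"
  show "lattice_edges \<noteq> ({} :: (int ^ 'd) set set)" by (rule lattice_edges_nonempty)
  show "(\<lambda>U. U e) \<in> measurable ?M unit_uniform" if "e \<in> lattice_edges" for e
    unfolding clock_measure_eq using that by (rule measurable_component_singleton)
  have "distr ?M (Pi\<^sub>M lattice_edges (\<lambda>_. unit_uniform)) (\<lambda>U. \<lambda>e\<in>lattice_edges. U e) =
      distr ?M ?M (\<lambda>U. U)"
    by (rule distr_cong)
      (auto simp: clock_measure_eq space_PiM PiE_def intro: extensional_restrict)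
  also have "\<dots> = ?M" by (rule distr_id)
  also have "\<dots> = (\<Pi>\<^sub>M e\<in>lattice_edges. distr ?M unit_uniform (\<lambda>U. U e))"
    unfolding clock_measure_eq by (intro PiM_cong refl) (simp add: clocks.PiM_component)
  finally show "distr ?M (Pi\<^sub>M lattice_edges (\<lambda>_. unit_uniform)) (\<lambda>U. \<lambda>e\<in>lattice_edges. U e) =
    (\<Pi>\<^sub>M e\<in>lattice_edges. distr ?M unit_uniform (\<lambda>U. U e))" .
qed

text \<open>Padding with the clock value 0 off \<open>J\<close> turns a configuration on
  \<open>J\<close> into a full one, and membership in \<open>B\<close> does not notice the padding.
  Independence of disjoint blocks of coordinates then applies.\<close>

lemma cylinder_restrict:
  assumes "cylinder B J"
  obtains B0 where "B0 \<in> sets (\<Pi>\<^sub>M e\<in>J. unit_uniform)"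
    "B = (\<lambda>U. \<lambda>e\<in>J. U e) -` B0 \<inter> space clock_measure"
proof -
  define ext where "ext V = (\<lambda>e\<in>lattice_edges. if e \<in> J then V e else (0 :: real))" for V :: "(int ^ 'a) set \<Rightarrow> real"
  have J: "J \<subseteq> lattice_edges" and B: "B \<in> sets clock_measure"
    using assms unfolding cylinder_def by auto
  have "(\<lambda>V. if e \<in> J then V e else 0) \<in> measurable (\<Pi>\<^sub>M e\<in>J. unit_uniform) unit_uniform" for e
    by (cases "e \<in> J") (auto intro: measurable_component_singleton)
  then have ext: "ext \<in> measurable (\<Pi>\<^sub>M e\<in>J. unit_uniform) clock_measure"
    unfolding clock_measure_eq ext_def by (intro measurable_restrict)
  let ?B0 = "ext -` B \<inter> space (\<Pi>\<^sub>M e\<in>J. unit_uniform)"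
  have "U \<in> B \<longleftrightarrow> ext (\<lambda>e\<in>J. U e) \<in> B \<and> (\<lambda>e\<in>J. U e) \<in> space (\<Pi>\<^sub>M e\<in>J. unit_uniform)"
    if U: "U \<in> space clock_measure" for U
  proof -
    have r: "(\<lambda>e\<in>J. U e) \<in> space (\<Pi>\<^sub>M e\<in>J. unit_uniform)"
      using U J by (auto simp: space_clock_measure space_PiM)
    then have "ext (\<lambda>e\<in>J. U e) \<in> space clock_measure" by (rule measurable_space[OF ext])
    moreover have "\<forall>e\<in>J. U e = ext (\<lambda>e\<in>J. U e) e" using J by (auto simp: ext_def)
    ultimately show ?thesis using assms U r unfolding cylinder_def by blast
  qed
  then have "B = (\<lambda>U. \<lambda>e\<in>J. U e) -` ?B0 \<inter> space clock_measure"
    using sets.sets_into_space[OF B] by auto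
  moreover have "?B0 \<in> sets (\<Pi>\<^sub>M e\<in>J. unit_uniform)" using ext B by (rule measurable_sets)
  ultimately show ?thesis using that by blast
qed

lemma indep_cylinders:
  assumes "cylinder B J" "cylinder B' J'" "J \<inter> J' = {}"
  shows "measure clock_measure (B \<inter> B') = measure clock_measure B * measure clock_measure B'"
proof -
  obtain B0 where B0: "B0 \<in> sets (\<Pi>\<^sub>M e\<in>J. unit_uniform)"
    "B = (\<lambda>U. \<lambda>e\<in>J. U e) -` B0 \<inter> space clock_measure"
    using cylinder_restrict[OF assms(1)] by blast
  obtain B1 where B1: "B1 \<in> sets (\<Pi>\<^sub>M e\<in>J'. unit_uniform)"
    "B' = (\<lambda>U. \<lambda>e\<in>J'. U e) -` B1 \<inter> space clock_measure"
    using cylinder_restrict[OF assms(2)] by blast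
  have "clock.indep_var (\<Pi>\<^sub>M e\<in>J. unit_uniform) (\<lambda>U. \<lambda>e\<in>J. U e) (\<Pi>\<^sub>M e\<in>J'. unit_uniform) (\<lambda>U. \<lambda>e\<in>J'. U e)"
    using assms by (intro clock.indep_var_restrict[OF indep_vars_clocks]) (auto simp: cylinder_def)
  from clock.indep_varD[OF this B0(1) B1(1)] show ?thesis
    unfolding B0(2) B1(2) by (simp add: vimage_def Int_def conj_ac cong: conj_cong)
qed

text \<open>The events with such approximations form a sigma-algebra that contains the
  one-coordinate events. A complement has the same symmetric difference; a countable union is first
  cut down to a finite one.\<close>

lemma cylinder_approx:
  fixes A :: "((int ^ 'd) set \<Rightarrow> real) set"
  assumes "A \<in> sets clock_measure" "\<epsilon> > 0"
  shows "\<exists>B J. cylinder B J \<and> measure clock_measure ((A - B) \<union> (B - A)) < \<epsilon>"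
proof -
  let ?\<Omega> = "(lattice_edges :: (int ^ 'd) set set) \<rightarrow>\<^sub>E space unit_uniform"
  let ?R = "{{U \<in> ?\<Omega>. U e \<in> X} | e X. e \<in> lattice_edges \<and> X \<in> sets unit_uniform}"
  have sets: "sets clock_measure = sigma_sets ?\<Omega> ?R"
    unfolding clock_measure_eq by (rule sets_PiM_single)
  have \<Omega>: "?\<Omega> = space clock_measure" by (simp add: space_clock_measure)
  have "A \<in> sigma_sets ?\<Omega> ?R" using assms(1) sets by simp
  then have "A \<in> sets clock_measure \<and> (\<forall>\<epsilon>>0. \<exists>B J. cylinder B J \<and> measure clock_measure ((A - B) \<union> (B - A)) < \<epsilon>)"
  proof (induction rule: sigma_sets.induct)
    case (Basic A)
    then obtain e X where A: "A = {U \<in> ?\<Omega>. U e \<in> X}" and e: "e \<in> lattice_edges" and X: "X \<in> sets unit_uniform" by blast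
    have As: "A \<in> sets clock_measure" using Basic unfolding sets by (rule sigma_sets.Basic)
    have "U \<in> A \<longleftrightarrow> V \<in> A" if "U \<in> ?\<Omega>" "V \<in> ?\<Omega>" "\<forall>e\<in>{e}. U e = V e" for U V
      using that unfolding A by simp
    then have "cylinder A {e}" unfolding cylinder_def \<Omega>[symmetric] using e As by blast
    moreover have "measure clock_measure ((A - A) \<union> (A - A)) < \<epsilon>" if "\<epsilon> > 0" for \<epsilon>
      using that by simp
    ultimately show ?case using As by blast
  next
    case Empty
    have "cylinder {} {}" unfolding cylinder_def by auto
    then show ?case by (auto intro!: exI[of _ "{}"] exI[of _ "{}"])
  next
    case (Compl A)
    show ?case
    proof (intro conjI allI impI)
      show "?\<Omega> - A \<in> sets clock_measure" unfolding \<Omega> using Compl by auto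
      fix \<epsilon> :: real assume "\<epsilon> > 0"
      then obtain B J where B: "cylinder B J" "measure clock_measure ((A - B) \<union> (B - A)) < \<epsilon>"
        using Compl by blast
      have "B \<subseteq> ?\<Omega>"
        using B(1) sets.sets_into_space[of B clock_measure] unfolding cylinder_def \<Omega> by simp
      moreover have "A \<subseteq> ?\<Omega>"
        using Compl sets.sets_into_space[of A clock_measure] unfolding \<Omega> by simp
      ultimately have "((?\<Omega> - A) - (?\<Omega> - B)) \<union> ((?\<Omega> - B) - (?\<Omega> - A)) = (A - B) \<union> (B - A)" by blast
      then show "\<exists>B J. cylinder B J \<and> measure clock_measure (((?\<Omega> - A) - B) \<union> (B - (?\<Omega> - A))) < \<epsilon>"
        using cylinder_Compl[OF B(1)] B(2) unfolding \<Omega> by (intro exI[of _ "space clock_measure - B"] exI[of _ J]) simp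
    qed
  next
    case (Union A)
    let ?U = "\<Union>i. A i"
    have A: "A i \<in> sets clock_measure" for i using Union by blast
    show ?case
    proof (intro conjI allI impI)
      show U: "?U \<in> sets clock_measure" using A by auto
      fix \<epsilon> :: real assume \<epsilon>: "\<epsilon> > 0"
      \<comment> \<open>The error is arbitrary in the induction because each step splits it in two
        halves.\<close>
      have fin: "\<exists>B J. cylinder B J \<and> measure clock_measure (((\<Union>i<n. A i) - B) \<union> (B - (\<Union>i<n. A i))) < \<delta>"
        if "\<delta> > 0" for n :: nat and \<delta> :: real
        using that
      proof (induction n arbitrary: \<delta>)
        case 0
        have "cylinder {} {}" unfolding cylinder_def by auto
        then show ?case using 0 by (auto intro!: exI[of _ "{}"] exI[of _ "{}"])
      next
        case (Suc n)
        then obtain B J where B: "cylinder B J"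
          "measure clock_measure (((\<Union>i<n. A i) - B) \<union> (B - (\<Union>i<n. A i))) < \<delta> / 2"
          using half_gt_zero by blast
        obtain B' J' where B': "cylinder B' J'" "measure clock_measure ((A n - B') \<union> (B' - A n)) < \<delta> / 2"
          using Union(2)[of n] Suc.prems half_gt_zero by blast
        have ms: "B \<in> sets clock_measure" "B' \<in> sets clock_measure" "(\<Union>i<n. A i) \<in> sets clock_measure"
          using B(1) B'(1) A unfolding cylinder_def by auto
        have "measure clock_measure (((\<Union>i<Suc n. A i) - (B \<union> B')) \<union> ((B \<union> B') - (\<Union>i<Suc n. A i))) \<le>
          measure clock_measure ((((\<Union>i<n. A i) - B) \<union> (B - (\<Union>i<n. A i))) \<union> ((A n - B') \<union> (B' - A n)))"
          using ms A by (intro clock.finite_measure_mono) (auto simp: lessThan_Suc)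
        also have "\<dots> \<le> measure clock_measure (((\<Union>i<n. A i) - B) \<union> (B - (\<Union>i<n. A i))) +
            measure clock_measure ((A n - B') \<union> (B' - A n))"
          using ms A by (intro measure_Un_le) auto
        also have "\<dots> < \<delta>" using B(2) B'(2) by simp
        finally show ?case using cylinder_Un[OF B(1) B'(1)] by blast
      qed
      have "(\<lambda>n. measure clock_measure (\<Union>i<n. A i)) \<longlonglongrightarrow> measure clock_measure (\<Union>n. \<Union>i<n. A i)"
        using A by (intro clock.finite_Lim_measure_incseq incseq_SucI) (auto simp: lessThan_Suc)
      also have "(\<Union>n. \<Union>i<n. A i) = ?U" by auto
      finally have "\<forall>\<^sub>F n in sequentially. measure clock_measure ?U - \<epsilon> / 2 < measure clock_measure (\<Union>i<n. A i)"
        using \<epsilon> by (intro order_tendstoD(1)) auto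
      then obtain n where n: "measure clock_measure ?U - \<epsilon> / 2 < measure clock_measure (\<Union>i<n. A i)"
        unfolding eventually_sequentially by blast
      obtain B J where B: "cylinder B J"
        "measure clock_measure (((\<Union>i<n. A i) - B) \<union> (B - (\<Union>i<n. A i))) < \<epsilon> / 2"
        using fin[of "\<epsilon> / 2" n] \<epsilon> by auto
      have ms: "B \<in> sets clock_measure" "(\<Union>i<n. A i) \<in> sets clock_measure"
        using B(1) A unfolding cylinder_def by auto
      have "measure clock_measure (?U - (\<Union>i<n. A i)) < \<epsilon> / 2"
        using n U ms by (subst clock.finite_measure_Diff) auto
      moreover have "measure clock_measure ((?U - B) \<union> (B - ?U)) \<le>
          measure clock_measure ((?U - (\<Union>i<n. A i)) \<union> (((\<Union>i<n. A i) - B) \<union> (B - (\<Union>i<n. A i))))"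
        using ms U by (intro clock.finite_measure_mono) auto
      moreover have "\<dots> \<le> measure clock_measure (?U - (\<Union>i<n. A i)) +
          measure clock_measure (((\<Union>i<n. A i) - B) \<union> (B - (\<Union>i<n. A i)))"
        using ms U by (intro measure_Un_le) auto
      ultimately show "\<exists>B J. cylinder B J \<and> measure clock_measure ((?U - B) \<union> (B - ?U)) < \<epsilon>"
        using B by (intro exI[of _ B] exI[of _ J]) auto
    qed
  qed
  then show ?thesis using assms(2) by blast
qed

text \<open>A vector that is not a difference of two vertices covered by \<open>J\<close> moves
  every edge of \<open>J\<close> out of \<open>J\<close>.\<close>

lemma shift_disjoint:
  assumes "finite J" "J \<subseteq> lattice_edges"
  obtains z where "J \<inter> translate z ` J = {}"
proof -
  have "finite (\<Union>J)"
  proof (rule finite_Union[OF assms(1)])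
    fix e assume "e \<in> J"
    then show "finite e" using assms(2) lattice_edgeE[of e] by blast
  qed
  then have "finite ((\<lambda>(w, v). w - v) ` (\<Union>J \<times> \<Union>J))" by auto
  then obtain z where z: "z \<notin> (\<lambda>(w, v). w - v) ` (\<Union>J \<times> \<Union>J)"
    using infinite_UNIV_vertices ex_new_if_finite by blast
  have "translate z e \<notin> J" if e: "e \<in> J" for e
  proof
    assume te: "translate z e \<in> J"
    obtain v where v: "v \<in> e" using lattice_edgeE[of e] e assms by blast
    then have "(v + z, v) \<in> \<Union>J \<times> \<Union>J" using te e by blast
    then have "(v + z) - v \<in> (\<lambda>(w, v). w - v) ` (\<Union>J \<times> \<Union>J)" by force
    then show False using z by simp
  qed
  then have "J \<inter> translate z ` J = {}" by blast
  then show ?thesis by (rule that)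
qed

text \<open>Mixing: \<open>A\<close> is close to a cylinder \<open>B\<close> and, by invariance, to
  a translate \<open>B'\<close> depending on disjoint coordinates. Independence makes the
  probability of \<open>A\<close> close to its own square.\<close>

lemma shift_zero_one:
  assumes A: "A \<in> sets clock_measure"
    and inv: "\<And>z U. U \<in> space clock_measure \<Longrightarrow> shift_clocks z U \<in> A \<longleftrightarrow> U \<in> A"
  shows "measure clock_measure A = 0 \<or> measure clock_measure A = 1"
proof -
  define p where "p = measure clock_measure A"
  \<comment> \<open>Replacing \<open>A\<close> by \<open>B \<inter> B'\<close> costs at most
    \<open>2 * \<epsilon>\<close>, and so does replacing \<open>b * b\<close> by
    \<open>p * p\<close>.\<close>
  have "\<bar>p - p * p\<bar> \<le> 4 * \<epsilon>" if \<epsilon>: "\<epsilon> > 0" for \<epsilon>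
  proof -
    obtain B J where BJ: "cylinder B J" and d: "measure clock_measure ((A - B) \<union> (B - A)) < \<epsilon>"
      using cylinder_approx[OF A \<epsilon>] by blast
    have B: "B \<in> sets clock_measure" using BJ unfolding cylinder_def by blast
    obtain z where z: "J \<inter> translate z ` J = {}"
      using shift_disjoint BJ unfolding cylinder_def by blast
    define B' where "B' = shift_clocks z -` B \<inter> space clock_measure"
    define b where "b = measure clock_measure B"
    have BJ': "cylinder B' (translate z ` J)" unfolding B'_def by (rule cylinder_shift[OF BJ])
    have B': "B' \<in> sets clock_measure" using BJ' unfolding cylinder_def by blast
    have b': "measure clock_measure B' = b"
      unfolding B'_def b_def measure_def emeasure_shift[OF B] ..
    have "shift_clocks z -` ((A - B) \<union> (B - A)) \<inter> space clock_measure = (A - B') \<union> (B' - A)"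
      using inv sets.sets_into_space[OF A] unfolding B'_def by auto
    then have d': "measure clock_measure ((A - B') \<union> (B' - A)) < \<epsilon>"
      using d emeasure_shift[of "(A - B) \<union> (B - A)" z] A B by (simp add: measure_def)
    have close: "\<bar>measure clock_measure C - measure clock_measure D\<bar> \<le> measure clock_measure ((C - D) \<union> (D - C))"
      if "C \<in> sets clock_measure" "D \<in> sets clock_measure" for C D :: "((int ^ 'a) set \<Rightarrow> real) set"
    proof -
      have *: "measure clock_measure C \<le> measure clock_measure D + measure clock_measure ((C - D) \<union> (D - C))"
        if "C \<in> sets clock_measure" "D \<in> sets clock_measure" for C D :: "((int ^ 'a) set \<Rightarrow> real) set"
      proof -
        have "measure clock_measure C \<le> measure clock_measure (D \<union> ((C - D) \<union> (D - C)))"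
          using that by (intro clock.finite_measure_mono) auto
        also have "\<dots> \<le> measure clock_measure D + measure clock_measure ((C - D) \<union> (D - C))"
          using that by (intro measure_Un_le) auto
        finally show ?thesis .
      qed
      show ?thesis using *[OF that] *[OF that(2,1)] by (simp add: Un_commute abs_le_iff)
    qed
    have pb: "\<bar>p - b\<bar> < \<epsilon>" using close[OF A B] d unfolding p_def b_def by linarith
    have "\<bar>p - measure clock_measure (B \<inter> B')\<bar> \<le> measure clock_measure ((A - (B \<inter> B')) \<union> ((B \<inter> B') - A))"
      unfolding p_def using A B B' by (intro close) auto
    also have "\<dots> \<le> measure clock_measure (((A - B) \<union> (B - A)) \<union> ((A - B') \<union> (B' - A)))"
      using A B B' by (intro clock.finite_measure_mono) auto
    also have "\<dots> \<le> measure clock_measure ((A - B) \<union> (B - A)) + measure clock_measure ((A - B') \<union> (B' - A))"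
      using A B B' by (intro measure_Un_le) auto
    also have "\<dots> \<le> 2 * \<epsilon>" using d d' by simp
    finally have 1: "\<bar>p - b * b\<bar> \<le> 2 * \<epsilon>"
      unfolding indep_cylinders[OF BJ BJ' z] b' b_def[symmetric] .
    have "b * b - p * p = (b - p) * (b + p)" by (simp add: algebra_simps)
    then have "\<bar>b * b - p * p\<bar> = \<bar>b - p\<bar> * \<bar>b + p\<bar>" by (simp add: abs_mult)
    also have "\<dots> \<le> \<epsilon> * 2"
      using pb by (intro mult_mono) (auto simp: b_def p_def intro: order_trans[OF add_mono[OF clock.prob_le_1 clock.prob_le_1]])
    finally show ?thesis using 1 by linarith
  qed
  then have "\<bar>p - p * p\<bar> \<le> \<delta>" if "\<delta> > 0" for \<delta>
    using that[THEN divide_pos_pos[of _ 4]] by (metis mult.commute nonzero_eq_divide_eq zero_less_numeral zero_neq_numeral)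
  then have "p - p * p = 0" using dense_ge[of 0 "\<bar>p - p * p\<bar>"] by fastforce
  then have "p * (1 - p) = 0" by (simp add: algebra_simps)
  then show ?thesis unfolding p_def by auto
qed

lemma AE_percolating:
  assumes "measure clock_measure {U \<in> space clock_measure. (0 :: int ^ 'd) \<in> percolating (open_by k U s)} > 0"
  shows "AE U in clock_measure. percolating (open_by k U s) \<noteq> ({} :: (int ^ 'd) set)"
proof -
  let ?M = "clock_measure :: ((int ^ 'd) set \<Rightarrow> real) measure"
  note pred_percolating[measurable]
  define A where "A = {U \<in> space ?M. \<exists>v. v \<in> percolating (open_by k U s)}"
  have A: "A \<in> sets ?M" unfolding A_def by measurable
  have inv: "shift_clocks z U \<in> A \<longleftrightarrow> U \<in> A" if U: "U \<in> space ?M" for z U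
  proof -
    have "(\<exists>v. v + z \<in> percolating (open_by k U s)) \<longleftrightarrow> (\<exists>v. v \<in> percolating (open_by k U s))"
      by (metis diff_add_cancel)
    then show ?thesis
      using U measurable_space[OF measurable_shift U, of z]
      unfolding A_def by (simp add: open_by_shift percolating_shift)
  qed
  have "0 < measure ?M {U \<in> space ?M. 0 \<in> percolating (open_by k U s)}" by fact
  also have "\<dots> \<le> measure ?M A"
    using A by (intro clock.finite_measure_mono) (auto simp: A_def)
  finally have "measure ?M A = 1" using shift_zero_one[OF A inv] by auto
  then have "AE U in ?M. U \<in> A" using A by (simp add: clock.AE_in_set_eq_1)
  then show ?thesis by (auto simp: A_def)
qed

section \<open>Resampling, mass transport and continuity\<close>

text \<open>Preimages of Lebesgue null sets under an affine map of positive slope are null; the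
  bounds on \<open>a\<close> and \<open>b\<close> keep the image in the unit interval.\<close>

lemma AE_affine_unit_uniform:
  assumes "AE x in unit_uniform. R x" "b > 0" "a \<ge> 0" "a + b \<le> 1"
  shows "AE x in unit_uniform. R (a + b * x)"
proof -
  have "AE x in lborel. x \<in> {0..1} \<longrightarrow> R x"
    using assms(1) unfolding unit_uniform_def by (subst (asm) AE_restrict_space_iff) auto
  then obtain N where N: "N \<in> null_sets lborel" "\<And>x. x \<in> {0..1} \<Longrightarrow> x \<notin> N \<Longrightarrow> R x"
    by (auto elim!: AE_E3)
  have "AE x in lborel. x \<notin> N" by (rule AE_not_in[OF N(1)])
  moreover have "Measurable.pred borel (\<lambda>x. x \<notin> N)" using N(1) by auto
  ultimately have "AE x in lborel. a + b * x \<notin> N"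
    using assms(2) by (intro AE_borel_affine) auto
  then have "AE x in lborel. x \<in> {0..1} \<longrightarrow> R (a + b * x)"
  proof (rule AE_mp, intro AE_I2 impI)
    fix x :: real assume x: "a + b * x \<notin> N" "x \<in> {0..1}"
    then have "0 \<le> b * x" "b * x \<le> b * 1"
      using assms(2) by (auto intro!: mult_left_mono)
    then have "0 \<le> a + b * x" "a + b * x \<le> 1" using assms(3,4) by linarith+
    then have "a + b * x \<in> {0..1}" by simp
    then show "R (a + b * x)" using N(2) x by blast
  qed
  then show ?thesis unfolding unit_uniform_def by (subst AE_restrict_space_iff) auto
qed

lemma clock_measure_insert:
  fixes e :: "(int ^ 'd) set"
  assumes e: "e \<in> lattice_edges"
  defines "M2 \<equiv> \<Pi>\<^sub>M f\<in>lattice_edges - {e}. unit_uniform"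
  shows "(\<lambda>(x, X). X(e := x)) \<in> measurable (unit_uniform \<Otimes>\<^sub>M M2) clock_measure"
    and "distr (unit_uniform \<Otimes>\<^sub>M M2) clock_measure (\<lambda>(x, X). X(e := x)) = clock_measure"
    and "pair_sigma_finite unit_uniform M2"
proof -
  have L: "insert e (lattice_edges - {e}) = lattice_edges" using e by auto
  show "distr (unit_uniform \<Otimes>\<^sub>M M2) clock_measure (\<lambda>(x, X). X(e := x)) = clock_measure"
    using distr_pair_PiM_eq_PiM[of "lattice_edges - {e}" "\<lambda>_. unit_uniform" e] prob_space_unit_uniform
    unfolding L M2_def clock_measure_eq by simp
  show "(\<lambda>(x, X). X(e := x)) \<in> measurable (unit_uniform \<Otimes>\<^sub>M M2) clock_measure"
    unfolding clock_measure_eq M2_def case_prod_beta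
    by (rule measurable_fun_upd[where J = "lattice_edges - {e}"]) (use L in auto)
  interpret M1: prob_space unit_uniform by (rule prob_space_unit_uniform)
  interpret M2: prob_space M2 unfolding M2_def by (intro prob_space_PiM prob_space_unit_uniform)
  show "pair_sigma_finite unit_uniform M2" ..
qed

text \<open>Fubini, with the clock of \<open>e\<close> as one variable and the others as the second,
  reduces this to the affine map of a single uniform variable.\<close>

lemma AE_clock_affine:
  fixes e :: "(int ^ 'd) set"
  assumes Q: "AE U in clock_measure. Q U" and e: "e \<in> lattice_edges" and ab: "b > 0" "a \<ge> 0" "a + b \<le> 1"
  shows "AE U in clock_measure. Q (U(e := a + b * U e))"
proof -
  define M2 where "M2 = (\<Pi>\<^sub>M f\<in>lattice_edges - {e}. unit_uniform)"
  note ins = clock_measure_insert[OF e, folded M2_def]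
  interpret pair: pair_sigma_finite unit_uniform M2 by (rule ins(3))
  let ?M = "clock_measure :: ((int ^ 'd) set \<Rightarrow> real) measure"
  \<comment> \<open>\<open>Q\<close> may be nonmeasurable, so the argument runs with a measurable
    null set outside which it holds.\<close>
  obtain N where N: "N \<in> null_sets ?M" "\<And>U. U \<in> space ?M \<Longrightarrow> U \<notin> N \<Longrightarrow> Q U"
    using Q by (auto elim!: AE_E3)
  have Ns [measurable]: "N \<in> sets ?M" using N(1) by auto
  have "AE U in distr (unit_uniform \<Otimes>\<^sub>M M2) ?M (\<lambda>(x, X). X(e := x)). U \<notin> N"
    unfolding ins(2) by (rule AE_not_in[OF N(1)])
  then have "AE z in unit_uniform \<Otimes>\<^sub>M M2. (case z of (x, X) \<Rightarrow> X(e := x)) \<notin> N"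
    by (rule AE_distrD[OF ins(1)])
  then have "AE x in unit_uniform. AE X in M2. X(e := x) \<notin> N"
    by (auto dest: pair.AE_pair)
  then have 3: "AE x in unit_uniform. AE X in M2. X(e := a + b * x) \<notin> N"
    by (rule AE_affine_unit_uniform) fact+
  have aff: "a + b * x \<in> {0..1}" if "x \<in> {0..1}" for x
  proof -
    have "0 \<le> b * x" "b * x \<le> b * 1" using that ab by (auto intro!: mult_left_mono)
    then have "0 \<le> a + b * x" "a + b * x \<le> 1" using ab by linarith+
    then show ?thesis by simp
  qed
  have G: "(\<lambda>U. U(e := a + b * U e)) \<in> measurable ?M ?M"
    unfolding clock_measure_eq
  proof (rule measurable_fun_upd[where J = lattice_edges])
    have "(\<lambda>U. U e) \<in> borel_measurable (Pi\<^sub>M lattice_edges (\<lambda>e. unit_uniform))"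
      using measurable_clock[of e] unfolding clock_measure_eq .
    then show "(\<lambda>U. a + b * U e) \<in> measurable (Pi\<^sub>M lattice_edges (\<lambda>e. unit_uniform)) unit_uniform"
      using e by (intro measurable_unit_uniform aff) (auto simp: space_PiM)
  qed (use e in auto)
  have G1: "(\<lambda>U. U(e := a + b * U e)) \<circ> (\<lambda>(x, X). X(e := x)) \<in> measurable (unit_uniform \<Otimes>\<^sub>M M2) ?M"
    using ins(1) G by (rule measurable_comp)
  have eq: "(\<lambda>U. U(e := a + b * U e)) \<circ> (\<lambda>(x, X). X(e := x)) = (\<lambda>z. (snd z)(e := a + b * fst z))"
    by (auto simp: fun_eq_iff)
  have "{z \<in> space (unit_uniform \<Otimes>\<^sub>M M2). (snd z)(e := a + b * fst z) \<notin> N} \<in> sets (unit_uniform \<Otimes>\<^sub>M M2)"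
    using G1 unfolding eq by measurable
  then have 4: "AE z in unit_uniform \<Otimes>\<^sub>M M2. (snd z)(e := a + b * fst z) \<notin> N"
    using 3 by (intro pair.AE_pair_measure) auto
  have "AE U in distr (unit_uniform \<Otimes>\<^sub>M M2) ?M (\<lambda>(x, X). X(e := x)). U(e := a + b * U e) \<notin> N"
  proof (subst AE_distr_iff[OF ins(1)])
    show "{U \<in> space ?M. U(e := a + b * U e) \<notin> N} \<in> sets ?M" using G by measurable
    show "AE z in unit_uniform \<Otimes>\<^sub>M M2. (case z of (x, X) \<Rightarrow> X(e := x))
        (e := a + b * (case z of (x, X) \<Rightarrow> X(e := x)) e) \<notin> N"
      using 4 by (simp add: case_prod_beta)
  qed
  then have "AE U in ?M. U(e := a + b * U e) \<notin> N" unfolding ins(2) .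
  then show ?thesis
    using AE_space by eventually_elim (use N(2) measurable_space[OF G] in blast)
qed

text \<open>One clock is moved at a time. Finiteness is essential: the event that infinitely many
  given clocks all exceed \<open>t\<close> is null.\<close>

lemma AE_resample:
  fixes H P :: "(int ^ 'd) set set"
  assumes Q: "AE U in clock_measure. Q U" and HP: "finite H" "finite P" "H \<union> P \<subseteq> lattice_edges"
    and r: "0 \<le> r" "r < t" "t < 1"
  shows "AE U in clock_measure. Q (resample H P r t U)"
proof -
  define a where "a e = (if e \<in> P then r else t)" for e
  define b where "b e = (if e \<in> P then t - r else 1 - t)" for e
  define G where "G F U = (\<lambda>e. if e \<in> F then a e + b e * U e else U e)" for F U
  have ab: "b e > 0" "a e \<ge> 0" "a e + b e \<le> 1" for e using r by (auto simp: a_def b_def)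
  have "AE U in clock_measure. Q (G F U)" if "finite F" "F \<subseteq> lattice_edges" for F
    using that
  proof (induction F rule: finite_induct)
    case empty
    then show ?case using Q by (simp add: G_def)
  next
    case (insert e F)
    have eq: "G (insert e F) U = G F (U(e := a e + b e * U e))" for U
      using insert.hyps by (auto simp: G_def fun_eq_iff)
    show ?case
      unfolding eq by (rule AE_clock_affine[OF insert.IH]) (use insert.prems ab in auto)
  qed
  from this[of "H \<union> P"] have "AE U in clock_measure. Q (G (H \<union> P) U)" using HP by auto
  moreover have "G (H \<union> P) U = resample H P r t U" for U
    by (auto simp: G_def a_def b_def resample_def fun_eq_iff)
  ultimately show ?thesis by simp
qed

text \<open>For a fixed second clock, the first one hits that value with probability zero. This
  rules out ties in the case \<open>k = 1\<close>.\<close>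

lemma AE_inj_on_clocks: "AE U in clock_measure. inj_on U (lattice_edges :: (int ^ 'd) set set)"
proof -
  let ?M = "clock_measure :: ((int ^ 'd) set \<Rightarrow> real) measure"
  have "AE U in ?M. U e \<noteq> U f" if e: "e \<in> lattice_edges" and f: "f \<in> lattice_edges" and "e \<noteq> f" for e f
  proof -
    define M2 where "M2 = (\<Pi>\<^sub>M f\<in>lattice_edges - {e}. unit_uniform)"
    note ins = clock_measure_insert[OF e, folded M2_def]
    interpret pair: pair_sigma_finite unit_uniform M2 by (rule ins(3))
    have "(\<lambda>X. X f) \<in> measurable M2 unit_uniform"
      unfolding M2_def using f \<open>e \<noteq> f\<close> by (intro measurable_component_singleton) auto
    then have [measurable]: "(\<lambda>X. X f) \<in> borel_measurable M2" by (rule measurable_from_unit_uniform)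
    have [measurable]: "(\<lambda>x. x) \<in> borel_measurable unit_uniform"
      by (rule measurable_from_unit_uniform) simp
    have ms: "{z \<in> space (unit_uniform \<Otimes>\<^sub>M M2). fst z \<noteq> snd z f} \<in> sets (unit_uniform \<Otimes>\<^sub>M M2)"
      by measurable
    have "AE x in unit_uniform. x \<noteq> c" for c
      unfolding unit_uniform_def using AE_lborel_singleton[of c] by (subst AE_restrict_space_iff) auto
    then have "AE x in unit_uniform. AE X in M2. x \<noteq> X f"
      using pair.AE_commute[OF ms] by simp
    then have "AE z in unit_uniform \<Otimes>\<^sub>M M2. fst z \<noteq> snd z f"
      using pair.AE_pair_iff[OF ms] by simp
    then have "AE U in distr (unit_uniform \<Otimes>\<^sub>M M2) ?M (\<lambda>(x, X). X(e := x)). U e \<noteq> U f"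
    proof (subst AE_distr_iff[OF ins(1)])
      show "{U \<in> space ?M. U e \<noteq> U f} \<in> sets ?M"
        by (rule borel_measurable_neq[OF measurable_clock measurable_clock])
    qed (use \<open>e \<noteq> f\<close> in \<open>simp add: case_prod_beta\<close>)
    then show ?thesis unfolding ins(2) .
  qed
  then have "AE U in ?M. e \<noteq> f \<longrightarrow> U e \<noteq> U f" if "e \<in> lattice_edges" "f \<in> lattice_edges" for e f
    using that by (cases "e = f") auto
  then have "AE U in ?M. \<forall>e\<in>lattice_edges. \<forall>f\<in>lattice_edges. e \<noteq> f \<longrightarrow> U e \<noteq> U f"
    unfolding AE_ball_countable[OF countable_lattice_edges] by (intro ballI)
  then show ?thesis by eventually_elim (auto simp: inj_on_def)
qed

section \<open>Mass transport to the nearest targets\<close>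

text \<open>Equal shares avoid a choice among ties, and the rule commutes with translations.\<close>

definition transport :: "(int ^ 'd) set set \<Rightarrow> (int ^ 'd) set \<Rightarrow> int ^ 'd \<Rightarrow> int ^ 'd \<Rightarrow> ennreal" where
  "transport B I v z = (if z \<in> nearest B I v then ennreal (1 / real (card (nearest B I v))) else 0)"

lemma transport_out:
  assumes "B \<subseteq> lattice_edges"
  shows "(\<integral>\<^sup>+z. transport B I v z \<partial>count_space UNIV) \<le> 1"
proof -
  have fin: "finite (nearest B I v)" by (rule finite_nearest[OF assms])
  have "(\<integral>\<^sup>+z. transport B I v z \<partial>count_space UNIV) = (\<Sum>z\<in>nearest B I v. transport B I v z)"
    by (rule nn_integral_count_space'[OF fin]) (auto simp: transport_def)
  also have "\<dots> = (\<Sum>z\<in>nearest B I v. ennreal (1 / real (card (nearest B I v))))"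
    by (rule sum.cong) (auto simp: transport_def)
  also have "\<dots> = ennreal (\<Sum>z\<in>nearest B I v. 1 / real (card (nearest B I v)))"
    by (rule sum_ennreal) simp
  also have "(\<Sum>z\<in>nearest B I v. 1 / real (card (nearest B I v))) \<le> 1" by simp
  then have "ennreal (\<Sum>z\<in>nearest B I v. 1 / real (card (nearest B I v))) \<le> ennreal 1"
    by (rule ennreal_leI)
  finally show ?thesis by simp
qed

lemma transport_in_infinite:
  assumes B: "B \<subseteq> lattice_edges" and K: "infinite K" and z: "z \<in> nearest B I x"
    and eq: "\<And>v. v \<in> K \<Longrightarrow> nearest B I v = nearest B I x"
  shows "(\<integral>\<^sup>+v. transport B I v z \<partial>count_space UNIV) = \<infinity>"
proof -
  define c where "c = 1 / real (card (nearest B I x))"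
  have "card (nearest B I x) > 0" using finite_nearest[OF B] z by (auto simp: card_gt_0_iff)
  then have c: "c > 0" unfolding c_def by simp
  have "\<infinity> = ennreal c * emeasure (count_space UNIV) K"
    using K c by (simp add: emeasure_count_space ennreal_mult_top)
  also have "\<dots> = (\<integral>\<^sup>+v. ennreal c * indicator K v \<partial>count_space UNIV)"
    by (simp add: nn_integral_cmult_indicator)
  also have "\<dots> \<le> (\<integral>\<^sup>+v. transport B I v z \<partial>count_space UNIV)"
    by (rule nn_integral_mono) (use eq z in \<open>auto simp: transport_def c_def indicator_def\<close>)
  finally show ?thesis by (simp add: top_unique)
qed

lemma transport_shift:
  "transport {e. translate a e \<in> B} {v. v + a \<in> I} v z = transport B I (v + a) (z + a)"
proof -
  have "nearest B I (v + a) = (\<lambda>w. w + a) ` nearest {e. translate a e \<in> B} {v. v + a \<in> I} v"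
    using image_translate_Collect[of a "\<lambda>w. w \<in> nearest B I (v + a)"]
    by (simp add: nearest_shift[symmetric])
  then have "card (nearest B I (v + a)) = card (nearest {e. translate a e \<in> B} {v. v + a \<in> I} v)"
    by (simp add: card_image inj_on_def)
  then show ?thesis unfolding transport_def nearest_shift by simp
qed

lemma measurable_transport:
  fixes B :: "'a \<Rightarrow> (int ^ 'd) set set"
  assumes B: "\<And>e. Measurable.pred M (\<lambda>U. e \<in> B U)" and I: "\<And>v. Measurable.pred M (\<lambda>U. v \<in> I U)"
    and BL: "\<And>U. B U \<subseteq> lattice_edges"
  shows "(\<lambda>U. transport (B U) (I U) v z) \<in> borel_measurable M"
proof -
  have n [measurable]: "Measurable.pred M (\<lambda>U. z \<in> nearest (B U) (I U) v)" for z
    by (rule pred_nearest[OF B I])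
  have c [measurable]: "Measurable.pred M (\<lambda>U. card (nearest (B U) (I U) v) < k)" for k
    by (rule pred_card_less[OF n finite_nearest[OF BL]])
  have "(\<lambda>U. card (nearest (B U) (I U) v)) \<in> measurable M (count_space UNIV)"
    unfolding measurable_count_space_eq2_countable
  proof (intro conjI ballI)
    fix k
    have "(\<lambda>U. card (nearest (B U) (I U) v)) -` {k} \<inter> space M =
        {U \<in> space M. card (nearest (B U) (I U) v) < Suc k \<and> \<not> card (nearest (B U) (I U) v) < k}"
      by auto
    also have "\<dots> \<in> sets M" by measurable
    finally show "(\<lambda>U. card (nearest (B U) (I U) v)) -` {k} \<inter> space M \<in> sets M" .
  qed simp
  then have [measurable]: "(\<lambda>U. ennreal (1 / real (card (nearest (B U) (I U) v)))) \<in> borel_measurable M"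
    by (rule measurable_compose) simp
  show ?thesis unfolding transport_def by measurable
qed

text \<open>Mass transport principle: by translation invariance, the expected mass received by the
  origin equals the expected mass it sends.\<close>

lemma AE_transport_finite:
  "AE U in clock_measure. \<forall>z :: int ^ 'd.
     (\<integral>\<^sup>+v. transport (open_by k U t) (percolating (open_by k U s)) v z \<partial>count_space UNIV) \<noteq> \<infinity>"
proof -
  let ?M = "clock_measure :: ((int ^ 'd) set \<Rightarrow> real) measure"
  define T where "T v z U = transport (open_by k U t) (percolating (open_by k U s)) v z"
    for v z :: "int ^ 'd" and U
  have T [measurable]: "T v z \<in> borel_measurable ?M" for v z
    unfolding T_def
    by (rule measurable_transport[OF pred_open_by pred_percolating[OF pred_open_by] open_by_lattice])
  have T_shift: "T v z (shift_clocks a U) = T (v + a) (z + a) U" for v z a U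
    unfolding T_def open_by_shift
    using transport_shift[of a "open_by k U t" "percolating (open_by k U s)" v z]
    by (simp add: percolating_shift[symmetric])
  \<comment> \<open>The shift by \<open>v\<close> turns mass sent from \<open>0\<close> to
    \<open>- v\<close> into mass sent from \<open>v\<close> to \<open>0\<close>.\<close>
  have E: "(\<integral>\<^sup>+U. T v 0 U \<partial>?M) = (\<integral>\<^sup>+U. T 0 (- v) U \<partial>?M)" for v
  proof -
    have "(\<integral>\<^sup>+U. T 0 (- v) U \<partial>?M) = (\<integral>\<^sup>+U. T 0 (- v) U \<partial>distr ?M ?M (shift_clocks v))"
      by (simp only: distr_shift)
    also have "\<dots> = (\<integral>\<^sup>+U. T 0 (- v) (shift_clocks v U) \<partial>?M)"
      by (rule nn_integral_distr) measurable
    also have "\<dots> = (\<integral>\<^sup>+U. T v 0 U \<partial>?M)" by (simp add: T_shift)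
    finally show ?thesis by simp
  qed
  have "(\<integral>\<^sup>+U. \<integral>\<^sup>+v. T v 0 U \<partial>count_space UNIV \<partial>?M) = (\<integral>\<^sup>+v. \<integral>\<^sup>+U. T v 0 U \<partial>?M \<partial>count_space UNIV)"
    by (rule nn_integral_count_space_nn_integral) auto
  also have "\<dots> = (\<integral>\<^sup>+v. \<integral>\<^sup>+U. T 0 (- v) U \<partial>?M \<partial>count_space UNIV)"
    by (simp only: E)
  also have "\<dots> = (\<integral>\<^sup>+z. \<integral>\<^sup>+U. T 0 z U \<partial>?M \<partial>count_space UNIV)"
    by (rule nn_integral_bij_count_space) (simp add: bij_uminus)
  also have "\<dots> = (\<integral>\<^sup>+U. \<integral>\<^sup>+z. T 0 z U \<partial>count_space UNIV \<partial>?M)"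
    by (rule nn_integral_count_space_nn_integral[symmetric]) auto
  also have "\<dots> \<le> (\<integral>\<^sup>+U. 1 \<partial>?M)"
    unfolding T_def by (intro nn_integral_mono transport_out open_by_lattice)
  also have "\<dots> = 1" by (simp add: clock.emeasure_space_1)
  finally have le: "(\<integral>\<^sup>+U. \<integral>\<^sup>+v. T v 0 U \<partial>count_space UNIV \<partial>?M) \<le> 1" .
  have "(\<lambda>(v, U). T v 0 U) \<in> borel_measurable (count_space UNIV \<Otimes>\<^sub>M ?M)"
    by (rule measurable_pair_measure_countable1) auto
  then have "(\<lambda>(U, v). T v 0 U) \<in> borel_measurable (?M \<Otimes>\<^sub>M count_space UNIV)"
    by (subst measurable_pair_swap_iff) (simp add: case_prod_beta)
  then have "(\<lambda>U. \<integral>\<^sup>+v. T v 0 U \<partial>count_space UNIV) \<in> borel_measurable ?M"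
    by (rule sigma_finite_measure.borel_measurable_nn_integral[OF
          sigma_finite_measure_count_space_countable[OF countableI_type]])
  then have "AE U in ?M. (\<integral>\<^sup>+v. T v 0 U \<partial>count_space UNIV) \<noteq> \<infinity>"
    by (rule nn_integral_PInf_AE) (use le in \<open>auto simp: top_unique\<close>)
  \<comment> \<open>Finiteness at the origin is carried to every vertex \<open>z\<close> by a
    shift.\<close>
  then have 0: "AE U in ?M. (\<integral>\<^sup>+v. T v 0 (shift_clocks z U) \<partial>count_space UNIV) \<noteq> \<infinity>" for z
    by (rule AE_shift)
  have "(\<integral>\<^sup>+v. T v 0 (shift_clocks z U) \<partial>count_space UNIV) = (\<integral>\<^sup>+v. T v z U \<partial>count_space UNIV)" for z U
  proof -
    have "(\<integral>\<^sup>+v. T (v + z) z U \<partial>count_space UNIV) = (\<integral>\<^sup>+v. T v z U \<partial>count_space UNIV)"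
      by (rule nn_integral_bij_count_space) (simp add: bij_plus_right)
    then show ?thesis by (simp add: T_shift)
  qed
  then have "AE U in ?M. (\<integral>\<^sup>+v. T v z U \<partial>count_space UNIV) \<noteq> \<infinity>" for z
    using 0[of z] by simp
  then have "AE U in ?M. \<forall>z. (\<integral>\<^sup>+v. T v z U \<partial>count_space UNIV) \<noteq> \<infinity>"
    unfolding AE_all_countable by blast
  then show ?thesis unfolding T_def .
qed

section \<open>Left continuity and the conclusion\<close>

text \<open>The surgery depends on the configuration, whereas the exceptional null set has to be
  fixed beforehand. Hence \<open>Good\<close> is required for the clocks after every surgery of the
  countable family simultaneously.\<close>

lemma AE_percolating_earlier:
  assumes k: "k \<ge> 1" and t: "t < 1" and s: "0 \<le> s" "s < t"
    and pos: "measure clock_measure {U \<in> space clock_measure. (0 :: int ^ 'd) \<in> percolating (open_by k U s)} > 0"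
  shows "AE U in clock_measure. (0 :: int ^ 'd) \<in> percolating (open_by k U t) \<longrightarrow>
    (\<exists>u<t. 0 \<in> percolating (open_by k U u))"
proof (cases "k = 1")
  case True
  show ?thesis using AE_wf_earlier AE_inj_on_clocks
  proof eventually_elim
    case (elim U)
    \<comment> \<open>For \<open>k = 1\<close> the premise almost surely never holds.\<close>
    have "finite (open_cluster (open_by 1 U t) 0)"
      by (intro finite_cluster_degree_one open_by_lattice degree_one elim)
    then show ?case using True unfolding percolating_def by simp
  qed
next
  case False
  then have k2: "k \<ge> 2" using k by simp
  let ?M = "clock_measure :: ((int ^ 'd) set \<Rightarrow> real) measure"
  let ?T = "\<lambda>U z. \<integral>\<^sup>+v. transport (open_by k U t) (percolating (open_by k U s)) v z \<partial>count_space UNIV"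
  define Good where "Good U \<longleftrightarrow> wf (earlier U) \<and> (\<forall>z. ?T U z \<noteq> \<infinity>)" for U :: "(int ^ 'd) set \<Rightarrow> real"
  have good: "AE U in ?M. Good U"
    using AE_wf_earlier AE_transport_finite[of k t s] unfolding Good_def by eventually_elim blast
  define E where "E = {H :: (int ^ 'd) set set. finite H \<and> H \<subseteq> lattice_edges}"
  have E: "countable E" unfolding E_def by (rule countable_Collect_finite_subset[OF countable_lattice_edges])
  have "AE U in ?M. \<forall>H\<in>E. \<forall>P\<in>E. \<forall>r\<in>\<rat> \<inter> {s<..<t}. Good (resample H P r t U)"
    unfolding AE_ball_countable[OF E] AE_ball_countable[OF countable_Int1[OF countable_rat]]
    using s t by (intro ballI AE_resample good) (auto simp: E_def)
  moreover have "AE U in ?M. percolating (open_by k U s) \<noteq> {}" by (rule AE_percolating[OF pos])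
  ultimately show ?thesis using AE_wf_earlier AE_clock[of t]
  proof eventually_elim
    case (elim U)
    show ?case
    proof (intro impI, rule ccontr)
      assume inf: "0 \<in> percolating (open_by k U t)" and "\<not> (\<exists>u<t. 0 \<in> percolating (open_by k U u))"
      then have fin: "finite (open_cluster (open_by k U u) 0)" if "u < t" for u
        using that unfolding percolating_def by blast
      have ne: "U e \<noteq> t" if "e \<in> lattice_edges" for e using elim(4) that by blast
      have disj: "open_cluster (open_by k U t) 0 \<inter> percolating (open_by k U s) = {}"
        using no_earlier_infinite_cluster[OF ne fin _ s(2)] unfolding percolating_def by blast
      obtain H P r K x z where *: "finite H" "finite P" "H \<union> P \<subseteq> lattice_edges" "r \<in> \<rat>" "s < r" "r < t"
        "infinite K"
        "z \<in> nearest (open_by k (resample H P r t U) t) (percolating (open_by k (resample H P r t U) s)) x"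
        "\<And>u. u \<in> K \<Longrightarrow> nearest (open_by k (resample H P r t U) t) (percolating (open_by k (resample H P r t U) s)) u
          = nearest (open_by k (resample H P r t U) t) (percolating (open_by k (resample H P r t U) s)) x"
      proof (rule attach_cluster[OF k2 s(2) t elim(3)])
        show "0 < U e \<and> U e \<le> 1 \<and> U e \<noteq> t" if "e \<in> lattice_edges" for e using elim(4) that by blast
        show "wf (earlier (resample H P r t U))"
          if "finite H" "finite P" "H \<union> P \<subseteq> lattice_edges" "r \<in> \<rat>" "s < r" "r < t" for H P r
          using elim(1) that unfolding Good_def E_def by auto
        show "infinite (open_cluster (open_by k U t) 0)" using inf unfolding percolating_def by simp
      qed (use disj elim(2) in auto)
      have "?T (resample H P r t U) z = \<infinity>"
        by (rule transport_in_infinite[OF open_by_lattice *(7-9)])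
      moreover have "Good (resample H P r t U)" using elim(1) * unfolding E_def by auto
      ultimately show False unfolding Good_def by blast
    qed
  qed
qed

text \<open>Monotonicity traps all nearby values between those at one point on either side, so one
  sequence per side suffices.\<close>

lemma mono_isCont:
  fixes f :: "real \<Rightarrow> real"
  assumes "mono f" and right: "(\<lambda>n. f (t + 1 / Suc n)) \<longlonglongrightarrow> f t"
    and left: "(\<lambda>n. f (t - 1 / Suc n)) \<longlonglongrightarrow> f t"
  shows "isCont f t"
  unfolding continuous_at_eps_delta
proof (intro allI impI)
  fix \<epsilon> :: real assume \<epsilon>: "\<epsilon> > 0"
  obtain n where n: "f (t + 1 / Suc n) < f t + \<epsilon>"
    using order_tendstoD(2)[OF right, of "f t + \<epsilon>"] \<epsilon> unfolding eventually_sequentially by auto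
  obtain m where m: "f t - \<epsilon> < f (t - 1 / Suc m)"
    using order_tendstoD(1)[OF left, of "f t - \<epsilon>"] \<epsilon> unfolding eventually_sequentially by auto
  show "\<exists>d>0. \<forall>x'. dist x' t < d \<longrightarrow> dist (f x') (f t) < \<epsilon>"
  proof (intro exI[of _ "min (1 / Suc n) (1 / Suc m)"] conjI allI impI)
    fix x assume "dist x t < min (1 / real (Suc n)) (1 / real (Suc m))"
    then have "x \<le> t + 1 / Suc n" "t - 1 / Suc m \<le> x" by (auto simp: dist_real_def)
    then have "f x \<le> f (t + 1 / Suc n)" "f (t - 1 / Suc m) \<le> f x" using \<open>mono f\<close> by (auto dest: monoD)
    then show "dist (f x) (f t) < \<epsilon>" using n m by (auto simp: dist_real_def)
  qed simp
qed

theorem theorem3: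
  fixes k :: nat
  assumes "k \<ge> 1" and "k \<le> 2 * CARD('d::finite)"
  shows "continuous_on {t::real. critical_time TYPE('d) k < ereal t \<and> t < 1}
           (percolation_function TYPE('d) k)"
proof (rule continuous_at_imp_continuous_on, rule ballI)
  fix t assume t_in: "t \<in> {t::real. critical_time TYPE('d) k < ereal t \<and> t < 1}"
  let ?M = "clock_measure :: ((int ^ 'd) set \<Rightarrow> real) measure"
  note pred_percolating[measurable]
  define A where "A t = {U \<in> space ?M. 0 \<in> percolating (open_by k U t)}" for t
  have A [measurable]: "A t \<in> sets ?M" for t unfolding A_def by measurable
  have A_mono: "s \<le> t \<Longrightarrow> A s \<subseteq> A t" for s t
    unfolding A_def using percolating_mono[OF open_by_mono[of s t k]] by blast
  have \<theta>: "percolation_function TYPE('d) k = (\<lambda>t. measure ?M (A t))"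
    unfolding A_def using percolation_function_eq[OF assms(1)] by (rule ext)
  \<comment> \<open>The infimum lies strictly below \<open>t\<close>, so some time before
    \<open>t\<close> already has a positive percolation probability.\<close>
  obtain s where s: "0 \<le> s" "s < t" "measure ?M (A s) > 0"
    using t_in unfolding critical_time_def \<theta> by (auto simp: Inf_less_iff)
  have t: "t < 1" using t_in by simp
  show "isCont (percolation_function TYPE('d) k) t"
    unfolding \<theta>
  proof (rule mono_isCont)
    show "mono (\<lambda>t. measure ?M (A t))"
      using A A_mono by (intro monoI clock.finite_measure_mono)
    have "(\<lambda>n. measure ?M (A (t + 1 / Suc n))) \<longlonglongrightarrow> measure ?M (\<Inter>n. A (t + 1 / Suc n))"
      using A by (intro clock.finite_Lim_measure_decseq decseq_SucI A_mono) (auto simp: frac_le)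
    also have "(\<Inter>n. A (t + 1 / Suc n)) = A t"
    proof
      show "A t \<subseteq> (\<Inter>n. A (t + 1 / Suc n))" by (intro INT_greatest A_mono) simp
      show "(\<Inter>n. A (t + 1 / Suc n)) \<subseteq> A t"
        unfolding A_def percolating_def using finite_cluster_later[of k _ t 0] by blast
    qed
    finally show "(\<lambda>n. measure ?M (A (t + 1 / Suc n))) \<longlonglongrightarrow> measure ?M (A t)" .
    have "(\<lambda>n. measure ?M (A (t - 1 / Suc n))) \<longlonglongrightarrow> measure ?M (\<Union>n. A (t - 1 / Suc n))"
      using A by (intro clock.finite_Lim_measure_incseq incseq_SucI A_mono) (auto simp: frac_le)
    also have "measure ?M (\<Union>n. A (t - 1 / Suc n)) = measure ?M (A t)"
    proof (rule clock.finite_measure_eq_AE)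
      have "AE U in ?M. 0 \<in> percolating (open_by k U t) \<longrightarrow> (\<exists>u<t. 0 \<in> percolating (open_by k U u))"
        using AE_percolating_earlier[OF assms(1) t s(1,2)] s(3) unfolding A_def by blast
      then show "AE U in ?M. U \<in> (\<Union>n. A (t - 1 / Suc n)) \<longleftrightarrow> U \<in> A t"
      proof (rule AE_mp, intro AE_I2 impI iffI)
        fix U assume U: "U \<in> space ?M" "0 \<in> percolating (open_by k U t) \<longrightarrow> (\<exists>u<t. 0 \<in> percolating (open_by k U u))"
        {
          assume "U \<in> (\<Union>n. A (t - 1 / Suc n))"
          then obtain n where "U \<in> A (t - 1 / Suc n)" by blast
          then show "U \<in> A t" using A_mono[of "t - 1 / Suc n" t] by auto
        next
          assume "U \<in> A t"
          then obtain u where u: "u < t" "U \<in> A u" using U unfolding A_def by blast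
          obtain n where "1 / Suc n < t - u" using u(1) nat_approx_posE[of "t - u"] by auto
          then have "U \<in> A (t - 1 / Suc n)" using u(2) A_mono[of u "t - 1 / Suc n"] by auto
          then show "U \<in> (\<Union>n. A (t - 1 / Suc n))" by blast
        }
      qed
    qed auto
    finally show "(\<lambda>n. measure ?M (A (t - 1 / Suc n))) \<longlonglongrightarrow> measure ?M (A t)" .
  qed
qed

end
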